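(* Let $\mu$ be a probability measure on $\mathbb{R}$ supported on some interval $I$. Let $q$ be its quantile function, let $N$ be a standard Gaussian variable, let $\Phi(x)=\int_{-\infty}^x e^{-s^2/2}\frac{ds}{\sqrt{2\pi}}$, and let $X=q(\Phi(N))$. (i) Assume that $\mu$ has finite moments of all orders, that $q$ is a $\mathscr{C}^\infty$-diffeomorphism from $(0,1)$ to $I$, and that for every integer $k\geq1$ $$\limsup_{t\to0^+}t^k|q^{(k)}(t)|<\infty,\qquad \limsup_{t\to1^-}(1-t)^k|q^{(k)}(t)|<\infty.$$ Then $X\in\mathbb{D}^\infty$. (ii) Assume that $q\in\mathscr{C}^1((0,1))$ and that $\mu$ admits a density in $L^{1+\varepsilon}$ for some $\varepsilon>0$. Then there exist $\theta>0$ and $C>0$ such that $\mathbf{P}[\Gamma(X,X)\leq\eta]\leq C\eta^\theta$ for all $\eta>0$. In particular, if the conditions in both (i) and (ii) hold, then $\mu\in\mathscr{L}$.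
   Context: Wiener space: the product $\bigotimes_{k\in\mathbb{N}} (\mathbb{R}, \mathfrak{B}(\mathbb{R}), \gamma)$ with $\gamma$ the standard Gaussian measure; its coordinates $(Y_k)$ are i.i.d. standard Gaussian, and $N$ is one of them. For smooth cylindrical $F,R$, $\Gamma(F,R) = \sum_k (\partial_{y_k}F)(\partial_{y_k}R)$ (carré du champ), extended by closure; for $X=T(N)$ with $T=q\circ\Phi$ of class $\mathscr{C}^1$, $\Gamma(X,X)=T'(N)^2$. $\mathsf{L}$ is the associated self-adjoint (Ornstein--Uhlenbeck) generator, characterized by $\mathbf{E}[\Gamma(F,R)] = -\mathbf{E}[F\,\mathsf{L}R]$. $\mathbb{D}^\infty = \{F : \mathsf{L}^k F \in \mathrm{Dom}(\mathsf{L}) \cap \bigcap_{1<p<\infty} L^p \text{ for all } k\geq 0\}$. $\mathscr{L}$ is the set of laws $\mu$ on $\mathbb{R}$ that can be realized as the law of some $X\in\mathbb{D}^\infty$ for which there is $\theta>0$ with $\mathbf{E}[\Gamma(X,X)^{-\theta}]<\infty$ (equivalently, $\mathbf{P}[\Gamma(X,X)\leq\eta]\lesssim\eta^{\theta'}$ for some $\theta'>0$). *)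

theory Defs
  imports "HOL-Probability.Probability"
begin

section \<open>Wiener space and smooth cylindrical functionals\<close>

definition wiener :: "(nat \<Rightarrow> real) measure" where
  "wiener = PiM UNIV (\<lambda>_. std_normal_distribution)"

definition partial :: "nat \<Rightarrow> ((nat \<Rightarrow> real) \<Rightarrow> real) \<Rightarrow> (nat \<Rightarrow> real) \<Rightarrow> real" where
  "partial k F y = deriv (\<lambda>t. F (y(k := t))) (y k)"

text \<open>
  Functions of finitely many coordinates, infinitely differentiable, all of whose iterated partial
  derivatives have polynomial growth.  Continuity refers to the product topology; for a function of
  the first \<open>n\<close> coordinates this is continuity on \<open>n\<close>-dimensional Euclidean space, so that existence
  and continuity of all iterated partial derivatives is smoothness in the usual sense.
\<close>

definition smooth_cylindrical :: "((nat \<Rightarrow> real) \<Rightarrow> real) \<Rightarrow> bool" where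
  "smooth_cylindrical F \<longleftrightarrow>
    (\<exists>n. (\<forall>y z. (\<forall>i<n. y i = z i) \<longrightarrow> F y = F z) \<and>
      (\<forall>ks. let D = foldr partial ks F in
         continuous_on UNIV D \<and>
         (\<forall>k y. (\<lambda>t. D (y(k := t))) differentiable (at (y k))) \<and>
         (\<exists>C m. \<forall>y. \<bar>D y\<bar> \<le> C * (1 + (\<Sum>i<n. \<bar>y i\<bar>)) ^ m)))"

text \<open>For cylindrical arguments only finitely many terms of the series are nonzero.\<close>

definition cyl_gamma ::
  "((nat \<Rightarrow> real) \<Rightarrow> real) \<Rightarrow> ((nat \<Rightarrow> real) \<Rightarrow> real) \<Rightarrow> (nat \<Rightarrow> real) \<Rightarrow> real" where
  "cyl_gamma F R y = (\<Sum>k. partial k F y * partial k R y)"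


section \<open>The carre du champ operator\<close>

definition Lp :: "real \<Rightarrow> ((nat \<Rightarrow> real) \<Rightarrow> real) set" where
  "Lp p = {F. F \<in> borel_measurable wiener \<and> integrable wiener (\<lambda>\<omega>. \<bar>F \<omega>\<bar> powr p)}"

text \<open>Convergence in the graph norm of the Dirichlet form: the smooth cylindrical \<open>S n\<close> converge to
  \<open>F\<close> in \<open>L\<^sup>2\<close> and form a Cauchy sequence for the energy.\<close>

definition energy_approx ::
  "(nat \<Rightarrow> (nat \<Rightarrow> real) \<Rightarrow> real) \<Rightarrow> ((nat \<Rightarrow> real) \<Rightarrow> real) \<Rightarrow> bool" where
  "energy_approx S F \<longleftrightarrow>
    F \<in> Lp 2 \<and> (\<forall>n. smooth_cylindrical (S n)) \<and>
    (\<lambda>n. \<integral>\<^sup>+\<omega>. ennreal ((S n \<omega> - F \<omega>)\<^sup>2) \<partial>wiener) \<longlonglongrightarrow> 0 \<and>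
    (\<forall>e>0. \<exists>M. \<forall>m\<ge>M. \<forall>n\<ge>M.
      (\<integral>\<^sup>+\<omega>. ennreal (cyl_gamma (\<lambda>y. S m y - S n y) (\<lambda>y. S m y - S n y) \<omega>) \<partial>wiener)
        < ennreal e)"

definition Dom_gamma :: "((nat \<Rightarrow> real) \<Rightarrow> real) set" where
  "Dom_gamma = {F. \<exists>S. energy_approx S F}"

text \<open>
  Random variables are represented by functions, so \<open>\<Gamma>(F, R)\<close> is an almost sure equivalence class.
  \<open>is_gamma F R G\<close> says that \<open>F\<close> and \<open>R\<close> belong to the domain of the closed form and that \<open>G\<close> is a
  version of \<open>\<Gamma>(F, R)\<close>.  Since the form is closable, any two versions agree almost surely.
\<close>

definition is_gamma ::
  "((nat \<Rightarrow> real) \<Rightarrow> real) \<Rightarrow> ((nat \<Rightarrow> real) \<Rightarrow> real) \<Rightarrow> ((nat \<Rightarrow> real) \<Rightarrow> real) \<Rightarrow> bool" where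
  "is_gamma F R G \<longleftrightarrow>
    G \<in> borel_measurable wiener \<and>
    (\<exists>S T. energy_approx S F \<and> energy_approx T R \<and>
      (\<lambda>n. \<integral>\<^sup>+\<omega>. ennreal \<bar>cyl_gamma (S n) (T n) \<omega> - G \<omega>\<bar> \<partial>wiener) \<longlonglongrightarrow> 0)"

text \<open>
  Extension to the local domain: \<open>q(\<Phi>(N))\<close> with \<open>q\<close> merely \<open>C\<^sup>1\<close> on the open unit interval need not
  be square integrable.  \<open>is_gamma_loc F G\<close> says that \<open>F\<close> coincides on each of countably many events
  \<open>A n\<close> covering the space with an element of \<open>Dom_gamma\<close>, and that \<open>G\<close> coincides there with its
  carre du champ.  By the locality property of \<open>\<Gamma>\<close>, such a \<open>G\<close> is almost surely unique, and it
  is \<open>T'(N)\<^sup>2\<close> when \<open>F = T(N)\<close> with \<open>T\<close> of class \<open>C\<^sup>1\<close>.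
\<close>

definition is_gamma_loc ::
  "((nat \<Rightarrow> real) \<Rightarrow> real) \<Rightarrow> ((nat \<Rightarrow> real) \<Rightarrow> real) \<Rightarrow> bool" where
  "is_gamma_loc F G \<longleftrightarrow>
    F \<in> borel_measurable wiener \<and> G \<in> borel_measurable wiener \<and>
    (\<exists>A H K. (\<forall>n::nat. A n \<in> sets wiener) \<and> (AE \<omega> in wiener. \<exists>n. \<omega> \<in> A n) \<and>
      (\<forall>n. is_gamma (H n) (H n) (K n) \<and>
           (AE \<omega> in wiener. \<omega> \<in> A n \<longrightarrow> F \<omega> = H n \<omega> \<and> G \<omega> = K n \<omega>)))"


section \<open>The Ornstein--Uhlenbeck generator and the class of laws\<close>

text \<open>\<open>is_generator R H\<close> says that \<open>R\<close> belongs to the domain of the generator \<open>L\<close> of the Dirichlet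
  form and that \<open>H\<close> is a version of \<open>L R\<close>.\<close>

definition is_generator ::
  "((nat \<Rightarrow> real) \<Rightarrow> real) \<Rightarrow> ((nat \<Rightarrow> real) \<Rightarrow> real) \<Rightarrow> bool" where
  "is_generator R H \<longleftrightarrow>
    R \<in> Dom_gamma \<and> H \<in> Lp 2 \<and>
    (\<forall>F G. is_gamma F R G \<longrightarrow>
      (\<integral>\<omega>. G \<omega> \<partial>wiener) = - (\<integral>\<omega>. F \<omega> * H \<omega> \<partial>wiener))"

text \<open>In the next definition \<open>G k\<close> is a version of the \<open>k\<close>-th iterate of \<open>L\<close> applied to \<open>F\<close>.\<close>

definition D_infty :: "((nat \<Rightarrow> real) \<Rightarrow> real) set" where
  "D_infty = {F. \<exists>G. G 0 = F \<and>
     (\<forall>k. is_generator (G k) (G (Suc k)) \<and> (\<forall>p>1. G k \<in> Lp p))}"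

text \<open>Since \<open>0 powr a = 0\<close> in HOL, the value \<open>\<infinity>\<close> of a negative power at \<open>0\<close> is put in by hand.\<close>

definition neg_power :: "real \<Rightarrow> real \<Rightarrow> ennreal" where
  "neg_power \<theta> x = (if x \<le> 0 then \<infinity> else ennreal (x powr (- \<theta>)))"

definition law_class :: "real measure set" where
  "law_class = {\<mu>. \<exists>X \<in> D_infty. distr wiener borel X = \<mu> \<and>
     (\<exists>\<theta>>0. \<exists>G. is_gamma X X G \<and> (\<integral>\<^sup>+\<omega>. neg_power \<theta> (G \<omega>) \<partial>wiener) < \<infinity>)}"


section \<open>Quantile functions and the hypotheses on them\<close>

definition quantile :: "real measure \<Rightarrow> real \<Rightarrow> real" where
  "quantile \<mu> t = Inf {x. t \<le> cdf \<mu> x}"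

definition Phi :: "real \<Rightarrow> real" where
  "Phi x = (LINT s:{..x}|lborel. exp (- s\<^sup>2 / 2) / sqrt (2 * pi))"

text \<open>The next definition is meant for open sets only.\<close>

definition smooth_on :: "real set \<Rightarrow> (real \<Rightarrow> real) \<Rightarrow> bool" where
  "smooth_on S f \<longleftrightarrow> (\<forall>k. \<forall>x\<in>S. ((deriv ^^ k) f) differentiable (at x))"

definition smooth_diffeo :: "real set \<Rightarrow> real set \<Rightarrow> (real \<Rightarrow> real) \<Rightarrow> bool" where
  "smooth_diffeo S T f \<longleftrightarrow>
    open S \<and> open T \<and> bij_betw f S T \<and> smooth_on S f \<and> smooth_on T (inv_into S f)"

definition smooth_quantile_condition :: "real measure \<Rightarrow> real set \<Rightarrow> bool" where
  "smooth_quantile_condition \<mu> I \<longleftrightarrow>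
    (\<forall>n::nat. integrable \<mu> (\<lambda>x. \<bar>x\<bar> ^ n)) \<and>
    smooth_diffeo {0<..<1} I (quantile \<mu>) \<and>
    (\<forall>k\<ge>1.
      Limsup (at_right 0) (\<lambda>t. ereal (t ^ k * \<bar>(deriv ^^ k) (quantile \<mu>) t\<bar>)) < \<infinity> \<and>
      Limsup (at_left 1) (\<lambda>t. ereal ((1 - t) ^ k * \<bar>(deriv ^^ k) (quantile \<mu>) t\<bar>)) < \<infinity>)"

definition density_condition :: "real measure \<Rightarrow> bool" where
  "density_condition \<mu> \<longleftrightarrow>
    quantile \<mu> C1_differentiable_on {0<..<1} \<and>
    (\<exists>\<epsilon>>0. \<exists>f. f \<in> borel_measurable borel \<and> (\<forall>x. 0 \<le> f x) \<and>
       \<mu> = density lborel (\<lambda>x. ennreal (f x)) \<and>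
       integrable lborel (\<lambda>x. f x powr (1 + \<epsilon>)))"

end

theory Submission
  imports Defs "HOL-Real_Asymp.Real_Asymp"
begin

text \<open>
  Write \<open>X = T(N)\<close> with \<open>T = q \<circ> \<Phi>\<close> and let \<open>\<phi>\<close> be the Gaussian density.

  (i) By a Mills ratio bound, \<open>\<phi>(x) \<le> c (1 + |x|) \<Phi>(x) (1 - \<Phi>(x))\<close>, so the hypotheses on \<open>q\<close> say
  that \<open>Q\<^sub>k = q\<^bsup>(k)\<^esup>(\<Phi>) \<phi>\<^sup>k\<close> has polynomial growth.  Since \<open>Q\<^sub>k' = Q\<^sub>k\<^sub>+\<^sub>1 - k x Q\<^sub>k\<close>, all derivatives of
  \<open>T = Q\<^sub>0\<close> have polynomial growth.  Hence \<open>X\<close> is itself a smooth cylindrical functional, and so are all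
  its images under \<open>L\<close>; integration by parts extends from smooth cylindrical functionals to the closed
  form by closability.

  (ii) Let \<open>A = {t. q'(t) \<le> s}\<close>.  Then \<open>q(A)\<close> has Lebesgue measure at most \<open>s\<close>, and the Lebesgue measure
  of \<open>A\<close> is \<open>\<mu>(q(A))\<close>, which is at most a power of \<open>s\<close> because the density is in \<open>L\<^bsup>1+\<epsilon>\<^esup>\<close>.  If
  \<open>T'(N) = q'(\<Phi>(N)) \<phi>(N)\<close> is small, one of the two factors is small.  For \<open>T\<close> merely \<open>C\<^sup>1\<close>, the carre
  du champ is obtained by freezing \<open>T'\<close> outside \<open>[-n, n]\<close> and approximating it uniformly by polynomials
  in \<open>\<Phi>\<close>.
\<close>

section \<open>Functions of one variable and the Gaussian measure\<close>

text \<open>Smooth cylindrical functionals are allowed polynomial growth rather than boundedness.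
  This shapes part (i): X lies in the core of the form without truncation or mollification, and only
  the derivatives of the one-variable function T have to be controlled. The bounds on q start at k =
  1, so the growth of T is recovered by integrating T'. The functional analysis sits in the
  generator: \<open>is_generator\<close> tests against every G reached along arbitrary
  approximations of both arguments, so the sequence approximating R cannot be chosen constant. It is
  written as R plus an approximation of zero, and closability disposes of the latter. In (ii) X need
  not be square integrable, hence the localized carre du champ. For the law class the two parts
  meet: (i) supplies the global carre du champ and (ii) its tail, which a dyadic sum turns into a
  negative moment of half the exponent.\<close>

definition poly_bounded :: "(real \<Rightarrow> real) \<Rightarrow> bool" where
  "poly_bounded f \<longleftrightarrow> (\<exists>C m. \<forall>x. \<bar>f x\<bar> \<le> C * (1 + \<bar>x\<bar>) ^ m)"

lemma growth_bound_mono: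
  fixes C D s :: real
  assumes "a \<le> C * (1 + s) ^ m" "C \<le> D" "0 \<le> D" "m \<le> n" "0 \<le> s"
  shows "a \<le> D * (1 + s) ^ n"
proof -
  have "C * (1 + s) ^ m \<le> D * (1 + s) ^ m"
    using assms by (intro mult_right_mono) auto
  also have "\<dots> \<le> D * (1 + s) ^ n"
    using assms by (intro mult_left_mono power_increasing) auto
  finally show ?thesis using assms(1) by simp
qed

lemma poly_boundedE:
  assumes "poly_bounded f"
  obtains C m where "0 \<le> C" "\<And>x. \<bar>f x\<bar> \<le> C * (1 + \<bar>x\<bar>) ^ m"
proof -
  obtain C m where *: "\<And>x. \<bar>f x\<bar> \<le> C * (1 + \<bar>x\<bar>) ^ m"
    using assms unfolding poly_bounded_def by blast
  have "0 \<le> C" using order_trans[OF abs_ge_zero *[of 0]] by simp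
  then show ?thesis using * that by blast
qed

lemma poly_boundedI: "(\<And>x. \<bar>f x\<bar> \<le> C * (1 + \<bar>x\<bar>) ^ m) \<Longrightarrow> poly_bounded f"
  unfolding poly_bounded_def by blast

lemma poly_bounded_const: "poly_bounded (\<lambda>_. c)"
  by (rule poly_boundedI[of _ "\<bar>c\<bar>" 0]) simp

lemma poly_bounded_ident: "poly_bounded (\<lambda>x. x)"
  by (rule poly_boundedI[of _ 1 1]) simp

lemma poly_bounded_add:
  assumes "poly_bounded f" "poly_bounded g" shows "poly_bounded (\<lambda>x. f x + g x)"
proof -
  obtain C m where f: "0 \<le> C" "\<And>x. \<bar>f x\<bar> \<le> C * (1 + \<bar>x\<bar>) ^ m" using assms poly_boundedE by blast
  obtain D n where g: "0 \<le> D" "\<And>x. \<bar>g x\<bar> \<le> D * (1 + \<bar>x\<bar>) ^ n" using assms poly_boundedE by blast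
  show ?thesis
  proof (rule poly_boundedI)
    fix x
    have "\<bar>f x\<bar> \<le> C * (1 + \<bar>x\<bar>) ^ max m n"
      by (rule growth_bound_mono[OF f(2)]) (use f in auto)
    moreover have "\<bar>g x\<bar> \<le> D * (1 + \<bar>x\<bar>) ^ max m n"
      by (rule growth_bound_mono[OF g(2)]) (use g in auto)
    ultimately show "\<bar>f x + g x\<bar> \<le> (C + D) * (1 + \<bar>x\<bar>) ^ max m n"
      unfolding distrib_right by linarith
  qed
qed

lemma poly_bounded_mult:
  assumes "poly_bounded f" "poly_bounded g" shows "poly_bounded (\<lambda>x. f x * g x)"
proof -
  obtain C m where f: "0 \<le> C" "\<And>x. \<bar>f x\<bar> \<le> C * (1 + \<bar>x\<bar>) ^ m" using assms poly_boundedE by blast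
  obtain D n where g: "0 \<le> D" "\<And>x. \<bar>g x\<bar> \<le> D * (1 + \<bar>x\<bar>) ^ n" using assms poly_boundedE by blast
  show ?thesis
  proof (rule poly_boundedI)
    fix x
    have "\<bar>f x\<bar> * \<bar>g x\<bar> \<le> (C * (1 + \<bar>x\<bar>) ^ m) * (D * (1 + \<bar>x\<bar>) ^ n)"
      using f g by (intro mult_mono) auto
    then show "\<bar>f x * g x\<bar> \<le> (C * D) * (1 + \<bar>x\<bar>) ^ (m + n)"
      by (simp add: abs_mult power_add ac_simps)
  qed
qed

text \<open>By the mean value bound on [-|x|, |x|], integration costs one degree of growth.\<close>

lemma poly_bounded_antiderivative:
  assumes g: "poly_bounded g" and d: "\<And>x. (f has_real_derivative g x) (at x)"
  shows "poly_bounded f"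
proof -
  obtain C m where g: "0 \<le> C" "\<And>x. \<bar>g x\<bar> \<le> C * (1 + \<bar>x\<bar>) ^ m" using g poly_boundedE by blast
  have "\<bar>f x\<bar> \<le> (\<bar>f 0\<bar> + C) * (1 + \<bar>x\<bar>) ^ (Suc m)" for x
  proof -
    have "norm (f x - f 0) \<le> (C * (1 + \<bar>x\<bar>) ^ m) * norm (x - 0)"
    proof (rule field_differentiable_bound[of "{-\<bar>x\<bar>..\<bar>x\<bar>}" f g])
      fix z assume z: "z \<in> {-\<bar>x\<bar>..\<bar>x\<bar>}"
      show "(f has_field_derivative g z) (at z within {-\<bar>x\<bar>..\<bar>x\<bar>})"
        using d DERIV_subset by blast
      have "\<bar>g z\<bar> \<le> C * (1 + \<bar>z\<bar>) ^ m" by (rule g)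
      also have "\<dots> \<le> C * (1 + \<bar>x\<bar>) ^ m"
        using z g by (intro mult_left_mono power_mono) auto
      finally show "norm (g z) \<le> C * (1 + \<bar>x\<bar>) ^ m" by simp
    qed auto
    also have "\<dots> \<le> C * (1 + \<bar>x\<bar>) ^ m * (1 + \<bar>x\<bar>)"
      using g by (intro mult_left_mono) auto
    finally have "\<bar>f x - f 0\<bar> \<le> C * (1 + \<bar>x\<bar>) ^ Suc m" by (simp add: ac_simps)
    moreover have "\<bar>f 0\<bar> * 1 \<le> \<bar>f 0\<bar> * (1 + \<bar>x\<bar>) ^ Suc m"
      by (intro mult_left_mono one_le_power) auto
    ultimately show ?thesis unfolding distrib_right by linarith
  qed
  then show ?thesis by (rule poly_boundedI)
qed

text \<open>Coinductively, \<open>tame f\<close> says that all iterated derivatives of \<open>f\<close> exist and have polynomial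
  growth; membership is proved by exhibiting an algebra that is closed under differentiation.\<close>

coinductive tame :: "(real \<Rightarrow> real) \<Rightarrow> bool" where
  "poly_bounded f \<Longrightarrow> (\<And>x. (f has_real_derivative g x) (at x)) \<Longrightarrow> tame g \<Longrightarrow> tame f"

text \<open>Serves for coinduction up to ring operations: the derivative of a generator may be any
  element of the algebra, not only another generator. The identity is included because
  differentiating the Gaussian density produces factors x.\<close>

inductive generated :: "((real \<Rightarrow> real) \<Rightarrow> bool) \<Rightarrow> (real \<Rightarrow> real) \<Rightarrow> bool" for B where
  base: "B f \<Longrightarrow> generated B f"
| const: "generated B (\<lambda>_. c)"
| ident: "generated B (\<lambda>x. x)"
| add: "generated B f \<Longrightarrow> generated B g \<Longrightarrow> generated B (\<lambda>x. f x + g x)"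
| mult: "generated B f \<Longrightarrow> generated B g \<Longrightarrow> generated B (\<lambda>x. f x * g x)"

text \<open>Membership in \<open>generated B\<close> is the coinductive invariant. The sum and
  product rules keep derivatives inside the algebra, so growth and differentiability have to be
  checked on the generators only.\<close>

lemma generated_tame:
  assumes B: "\<And>f. B f \<Longrightarrow> poly_bounded f \<and>
      (\<exists>g. generated B g \<and> (\<forall>x. (f has_real_derivative g x) (at x)))"
    and f: "generated B f"
  shows "tame f"
  using f
proof (coinduction arbitrary: f)
  case tame
  have "poly_bounded f \<and> (\<exists>g. generated B g \<and> (\<forall>x. (f has_real_derivative g x) (at x)))"
    using tame
  proof induction
    case (base f)
    then show ?case by (rule B)
  next
    case (const c)
    show ?case
      by (intro conjI poly_bounded_const exI[of _ "\<lambda>_. 0"] generated.const) (auto intro!: derivative_eq_intros)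
  next
    case ident
    show ?case
      by (intro conjI poly_bounded_ident exI[of _ "\<lambda>_. 1"] generated.const) (auto intro!: derivative_eq_intros)
  next
    case (add f g)
    then obtain f' g' where *: "generated B f'" "generated B g'"
      "\<And>x. (f has_real_derivative f' x) (at x)" "\<And>x. (g has_real_derivative g' x) (at x)" by blast
    show ?case
      using add * by (intro conjI poly_bounded_add exI[of _ "\<lambda>x. f' x + g' x"] generated.add)
        (auto intro!: derivative_eq_intros)
  next
    case (mult f g)
    then obtain f' g' where *: "generated B f'" "generated B g'"
      "\<And>x. (f has_real_derivative f' x) (at x)" "\<And>x. (g has_real_derivative g' x) (at x)" by blast
    show ?case
      using mult * by (intro conjI poly_bounded_mult exI[of _ "\<lambda>x. f x * g' x + f' x * g x"]
          generated.add generated.mult)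
        (auto intro!: derivative_eq_intros)
  qed
  then show ?case by blast
qed

text \<open>With \<open>tame\<close> itself as the set of generators, the derivative of a generator
  is again a generator. Closure of \<open>tame\<close> under sums and products comes from
  here.\<close>

lemma generated_tame_imp_tame: "generated tame f \<Longrightarrow> tame f"
  by (rule generated_tame[of tame]) (erule tame.cases; blast intro: generated.base)

lemma tame_add: "tame f \<Longrightarrow> tame g \<Longrightarrow> tame (\<lambda>x. f x + g x)"
  by (rule generated_tame_imp_tame, rule generated.add) (rule generated.base; assumption)+

lemma tame_mult: "tame f \<Longrightarrow> tame g \<Longrightarrow> tame (\<lambda>x. f x * g x)"
  by (rule generated_tame_imp_tame, rule generated.mult) (rule generated.base; assumption)+

lemma tame_const: "tame (\<lambda>_. c)"
  by (rule generated_tame_imp_tame, rule generated.const)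

lemma tame_ident: "tame (\<lambda>x. x)"
  by (rule generated_tame_imp_tame, rule generated.ident)

lemma tame_poly_bounded: "tame f \<Longrightarrow> poly_bounded f"
  by (erule tame.cases) simp

lemma tame_deriv:
  assumes "tame f"
  shows "(f has_real_derivative deriv f x) (at x)" "tame (deriv f)"
proof -
  obtain g where g: "\<And>x. (f has_real_derivative g x) (at x)" "tame g"
    using assms by (rule tame.cases) blast
  then have "deriv f = g" by (auto intro!: DERIV_imp_deriv)
  with g show "(f has_real_derivative deriv f x) (at x)" "tame (deriv f)" by auto
qed

lemma tame_continuous: "tame f \<Longrightarrow> continuous_on A f"
  by (rule continuous_at_imp_continuous_on) (blast intro: DERIV_isCont tame_deriv)

lemma tame_antiderivative:
  assumes "tame g" "\<And>x. (f has_real_derivative g x) (at x)" shows "tame f"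
  using assms poly_bounded_antiderivative tame_poly_bounded by (blast intro: tame.intros)

section \<open>Moments and integration by parts under the standard Gaussian measure\<close>

abbreviation gauss :: "real measure" where "gauss \<equiv> std_normal_distribution"

interpretation gauss: real_distribution gauss
  by (rule real_dist_normal_dist)

lemma integral_gauss:
  "f \<in> borel_measurable borel \<Longrightarrow> (\<integral>x. f x \<partial>gauss) = (\<integral>x. std_normal_density x * f x \<partial>lborel)"
  by (subst integral_density) (auto)

lemma integrable_gauss:
  "f \<in> borel_measurable borel \<Longrightarrow> integrable gauss f \<longleftrightarrow> integrable lborel (\<lambda>x. std_normal_density x * f x)"
  by (subst integrable_density) (auto)

text \<open>Reduces integrability of polynomial growth in many coordinates to absolute moments of
  single ones. If some \<open>a i\<close> exceeds 1, then \<open>1 + sum a A\<close> is at most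
  \<open>1 + card A\<close> times the largest term; otherwise it is at most
  \<open>1 + card A\<close>.\<close>

lemma growth_bound_sum:
  fixes a :: "'i \<Rightarrow> real"
  assumes A: "finite A" and a: "\<And>i. i \<in> A \<Longrightarrow> 0 \<le> a i"
  shows "(1 + sum a A) ^ m \<le> (1 + real (card A)) ^ m * (1 + (\<Sum>i\<in>A. a i ^ m))"
proof (cases "\<forall>i\<in>A. a i \<le> 1")
  case True
  have "sum a A \<le> real (card A) * 1" by (rule sum_bounded_above) (use True in auto)
  then have "(1 + sum a A) ^ m \<le> (1 + real (card A)) ^ m"
    using a by (intro power_mono) (auto intro!: sum_nonneg add_nonneg_nonneg)
  also have "\<dots> * 1 \<le> (1 + real (card A)) ^ m * (1 + (\<Sum>i\<in>A. a i ^ m))"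
    using a by (intro mult_left_mono) (auto intro!: sum_nonneg)
  finally show ?thesis by simp
next
  case False
  then have ne: "A \<noteq> {}" by auto
  define b where "b = Max (a ` A)"
  have b: "a i \<le> b" if "i \<in> A" for i using that A unfolding b_def by auto
  have "b \<in> a ` A" unfolding b_def using A ne by (intro Max_in) auto
  then obtain k where k: "k \<in> A" "b = a k" by auto
  have b1: "1 \<le> b" using False b by force
  have "sum a A \<le> real (card A) * b" by (rule sum_bounded_above) (use b in auto)
  then have "1 + sum a A \<le> (1 + real (card A)) * b" using b1 by (simp add: distrib_right)
  then have "(1 + sum a A) ^ m \<le> ((1 + real (card A)) * b) ^ m"
    using a by (intro power_mono) (auto intro!: sum_nonneg add_nonneg_nonneg)
  also have "\<dots> = (1 + real (card A)) ^ m * a k ^ m" using k by (simp add: power_mult_distrib)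
  also have "\<dots> \<le> (1 + real (card A)) ^ m * (1 + (\<Sum>i\<in>A. a i ^ m))"
  proof (intro mult_left_mono)
    have "a k ^ m \<le> (\<Sum>i\<in>A. a i ^ m)" using A a k by (intro member_le_sum) auto
    then show "a k ^ m \<le> 1 + (\<Sum>i\<in>A. a i ^ m)" by simp
  qed auto
  finally show ?thesis .
qed

lemma integrable_gauss_abs_power: "integrable gauss (\<lambda>x. \<bar>x\<bar> ^ m)"
  by (subst integrable_gauss) (auto intro: integrable_std_normal_moment_abs)

lemma integrable_gauss_poly_bounded:
  assumes [measurable]: "f \<in> borel_measurable borel" and f: "poly_bounded f"
  shows "integrable gauss f"
proof -
  obtain C m where C: "0 \<le> C" "\<And>x. \<bar>f x\<bar> \<le> C * (1 + \<bar>x\<bar>) ^ m" using f poly_boundedE by blast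
  show ?thesis
  proof (rule Bochner_Integration.integrable_bound)
    show "integrable gauss (\<lambda>x. C * (2 ^ m * (1 + \<bar>x\<bar> ^ m)))"
      by (intro integrable_mult_right Bochner_Integration.integrable_add integrable_gauss_abs_power gauss.integrable_const)
    show "AE x in gauss. norm (f x) \<le> norm (C * (2 ^ m * (1 + \<bar>x\<bar> ^ m)))"
    proof (rule AE_I2)
      fix x
      have "\<bar>f x\<bar> \<le> C * (1 + \<bar>x\<bar>) ^ m" by (rule C)
      also have "\<dots> \<le> C * (2 ^ m * (1 + \<bar>x\<bar> ^ m))"
        using growth_bound_sum[of "{()}" "\<lambda>_. \<bar>x\<bar>" m] C by (intro mult_left_mono) auto
      finally show "norm (f x) \<le> norm (C * (2 ^ m * (1 + \<bar>x\<bar> ^ m)))" using C by simp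
    qed
  qed simp
qed

lemma DERIV_std_normal_density:
  "(std_normal_density has_real_derivative - x * std_normal_density x) (at x)"
  unfolding std_normal_density_def[abs_def]
  by (rule derivative_eq_intros refl | simp)+

lemma poly_bounded_times_density_tendsto_0:
  assumes "poly_bounded f"
  shows "((\<lambda>x. f x * std_normal_density x) \<longlongrightarrow> 0) at_top"
    and "((\<lambda>x. f x * std_normal_density x) \<longlongrightarrow> 0) at_bot"
proof -
  obtain C m where C: "0 \<le> C" "\<And>x. \<bar>f x\<bar> \<le> C * (1 + \<bar>x\<bar>) ^ m" using assms poly_boundedE by blast
  have b: "norm (f x * std_normal_density x) \<le> C * ((1 + \<bar>x\<bar>) ^ m * std_normal_density x)" for x
    using mult_right_mono[OF C(2)[of x], of "std_normal_density x"] by (simp add: abs_mult ac_simps)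
  have "((\<lambda>x. (1 + \<bar>x\<bar>) ^ m * std_normal_density x) \<longlongrightarrow> 0) at_top"
    "((\<lambda>x. (1 + \<bar>x\<bar>) ^ m * std_normal_density x) \<longlongrightarrow> 0) at_bot"
    unfolding std_normal_density_def by real_asymp+
  from this[THEN tendsto_mult_right_zero, of C]
  show "((\<lambda>x. f x * std_normal_density x) \<longlongrightarrow> 0) at_top"
    "((\<lambda>x. f x * std_normal_density x) \<longlongrightarrow> 0) at_bot"
    by (auto intro: Lim_null_comparison[OF always_eventually, rule_format, OF b])
qed

text \<open>Stein's identity. The density phi satisfies phi' = -x phi, so (g' - x g) phi is the
  derivative of g phi, which vanishes at both infinities because g has polynomial growth.\<close>

lemma gauss_integration_by_parts:
  assumes d: "\<And>x. (g has_real_derivative g' x) (at x)" and c: "continuous_on UNIV g'"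
    and pg: "poly_bounded g" and pg': "poly_bounded g'"
  shows "(\<integral>x. g' x \<partial>gauss) = (\<integral>x. x * g x \<partial>gauss)"
proof -
  have cg: "continuous_on UNIV g"
    using d by (intro continuous_at_imp_continuous_on) (blast intro: DERIV_isCont)
  have m[measurable]: "g \<in> borel_measurable borel" "g' \<in> borel_measurable borel"
    using c cg by (auto intro: borel_measurable_continuous_onI)
  have i: "integrable gauss g'" "integrable gauss (\<lambda>x. x * g x)"
    using pg pg' by (auto intro!: integrable_gauss_poly_bounded poly_bounded_mult poly_bounded_ident)
  let ?h = "\<lambda>x. std_normal_density x * g' x - std_normal_density x * (x * g x)"
  have ih: "integrable lborel ?h"
    using i by (intro Bochner_Integration.integrable_diff) (auto simp: integrable_gauss)
  have "(LBINT x=-\<infinity>..\<infinity>. ?h x) = 0 - 0"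
  proof (rule interval_integral_FTC_integrable[where F="\<lambda>x. g x * std_normal_density x"])
    fix x :: real
    have "((\<lambda>x. g x * std_normal_density x) has_real_derivative ?h x) (at x)"
      by (auto intro!: derivative_eq_intros d DERIV_std_normal_density simp: algebra_simps)
    then show "((\<lambda>x. g x * std_normal_density x) has_vector_derivative ?h x) (at x)"
      by (simp add: has_real_derivative_iff_has_vector_derivative)
    have "continuous_on UNIV std_normal_density"
      by (intro continuous_at_imp_continuous_on) (blast intro: DERIV_isCont DERIV_std_normal_density)
    then have "continuous_on UNIV ?h" using c cg by (intro continuous_intros)
    then show "isCont ?h x" by (simp add: continuous_on_eq_continuous_at)
  next
    show "set_integrable lborel (einterval (-\<infinity>) \<infinity>) ?h"
      using ih by (simp add: set_integrable_def)
  qed (use poly_bounded_times_density_tendsto_0[OF pg] in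
      \<open>auto simp: ereal_tendsto_simps\<close>)
  then have "(\<integral>x. ?h x \<partial>lborel) = 0"
    by (simp add: interval_lebesgue_integral_def set_lebesgue_integral_def)
  then show ?thesis
    using i by (subst (asm) Bochner_Integration.integral_diff) (auto simp: integrable_gauss integral_gauss)
qed

section \<open>Integration by parts on Wiener space\<close>

interpretation wiener: prob_space wiener
  unfolding wiener_def by (rule prob_space_PiM) (rule gauss.prob_space_axioms)

lemma sets_wiener: "sets wiener = sets borel"
proof -
  have "sets wiener = sets (PiM UNIV (\<lambda>_::nat. borel :: real measure))"
    unfolding wiener_def by (intro sets_PiM_cong) auto
  then show ?thesis by (simp add: sets_PiM_equal_borel)
qed

lemma space_wiener[simp]: "space wiener = UNIV"
  unfolding wiener_def by (simp add: space_PiM)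

lemma borel_measurable_wiener_iff: "borel_measurable wiener = (borel_measurable borel :: ((nat \<Rightarrow> real) \<Rightarrow> real) set)"
  by (rule measurable_cong_sets) (auto simp: sets_wiener)

lemma measurable_coordinate[measurable]: "(\<lambda>\<omega>. \<omega> k) \<in> borel_measurable wiener"
  unfolding borel_measurable_wiener_iff by (intro borel_measurable_continuous_onI continuous_on_product_coordinates)

lemma distr_coordinate: "distr wiener borel (\<lambda>\<omega>. \<omega> k) = gauss"
proof -
  have "distr wiener borel (\<lambda>\<omega>. \<omega> k) = distr wiener gauss (\<lambda>\<omega>. \<omega> k)"
    by (rule distr_cong) auto
  also have "\<dots> = gauss"
    unfolding wiener_def by (rule distr_PiM_component) (auto intro: gauss.prob_space_axioms)
  finally show ?thesis .
qed

lemma integrable_coordinate: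
  fixes f :: "real \<Rightarrow> real"
  assumes [measurable]: "f \<in> borel_measurable borel"
  shows "integrable wiener (\<lambda>\<omega>. f (\<omega> k)) \<longleftrightarrow> integrable gauss f"
  by (subst distr_coordinate[of k, symmetric], subst integrable_distr_eq) auto

lemma measurable_resample:
  "(\<lambda>(x, X). X(k := x)) \<in> measurable (gauss \<Otimes>\<^sub>M wiener) wiener"
proof -
  have "(\<lambda>p. (snd p)(k := fst p)) \<in> measurable (gauss \<Otimes>\<^sub>M wiener) (PiM UNIV (\<lambda>_::nat. gauss))"
  proof (rule measurable_PiM_single')
    fix i
    have [measurable]: "(\<lambda>p. snd p i) \<in> borel_measurable (gauss \<Otimes>\<^sub>M wiener)"
      by (rule measurable_compose[OF measurable_snd measurable_coordinate])
    have "(\<lambda>p. ((snd p)(k := fst p)) i) = (\<lambda>p. if i = k then fst p else snd p i)" by auto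
    moreover have "\<dots> \<in> borel_measurable (gauss \<Otimes>\<^sub>M wiener)" by measurable
    ultimately show "(\<lambda>p. ((snd p)(k := fst p)) i) \<in> measurable (gauss \<Otimes>\<^sub>M wiener) gauss"
      by simp
  qed (auto simp: space_PiM)
  then show ?thesis by (simp add: wiener_def split_beta')
qed

lemma distr_resample: "distr (gauss \<Otimes>\<^sub>M wiener) wiener (\<lambda>(x, X). X(k := x)) = wiener"
  using distr_pair_PiM_eq_PiM[of UNIV "\<lambda>_. gauss" k] gauss.prob_space_axioms
  by (simp add: wiener_def)

text \<open>Fubini for one coordinate among infinitely many: overwriting coordinate \<open>k\<close>
  by an independent standard Gaussian leaves the law unchanged, so the product space need not be
  split.\<close>

lemma integral_resample:
  fixes F :: "(nat \<Rightarrow> real) \<Rightarrow> real"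
  assumes "integrable wiener F"
  shows "(\<integral>X. (\<integral>x. F (X(k := x)) \<partial>gauss) \<partial>wiener) = (\<integral>X. F X \<partial>wiener)"
proof -
  interpret pair_sigma_finite gauss wiener ..
  have m: "F \<in> borel_measurable wiener" using assms by auto
  have i: "integrable (gauss \<Otimes>\<^sub>M wiener) (\<lambda>p. F (case p of (x, X) \<Rightarrow> X(k := x)))"
    by (subst integrable_distr_eq[OF measurable_resample m, symmetric])
      (simp add: distr_resample assms)
  have "(\<integral>X. F X \<partial>wiener) = (\<integral>X. F X \<partial>distr (gauss \<Otimes>\<^sub>M wiener) wiener (\<lambda>(x, X). X(k := x)))"
    by (simp add: distr_resample)
  also have "\<dots> = (\<integral>p. F (case p of (x, X) \<Rightarrow> X(k := x)) \<partial>(gauss \<Otimes>\<^sub>M wiener))"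
    by (rule integral_distr[OF measurable_resample m])
  also have "\<dots> = (\<integral>(x, X). F (X(k := x)) \<partial>(gauss \<Otimes>\<^sub>M wiener))"
    by (simp add: split_beta')
  also have "\<dots> = (\<integral>X. (\<integral>x. F (X(k := x)) \<partial>gauss) \<partial>wiener)"
    by (rule integral_snd[symmetric]) (use i in \<open>simp add: split_beta'\<close>)
  finally show ?thesis ..
qed

section \<open>Continuous functionals of polynomial growth on Wiener space\<close>

definition poly_growth :: "((nat \<Rightarrow> real) \<Rightarrow> real) \<Rightarrow> bool" where
  "poly_growth F \<longleftrightarrow> continuous_on UNIV F \<and>
    (\<exists>n C m. \<forall>y. \<bar>F y\<bar> \<le> C * (1 + (\<Sum>i<n. \<bar>y i\<bar>)) ^ m)"

lemma poly_growthE: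
  assumes "poly_growth F"
  obtains n C m where "0 \<le> C" "\<And>y. \<bar>F y\<bar> \<le> C * (1 + (\<Sum>i<n. \<bar>y i\<bar>)) ^ m"
proof -
  obtain n C m where *: "\<And>y. \<bar>F y\<bar> \<le> C * (1 + (\<Sum>i<n. \<bar>y i\<bar>)) ^ m"
    using assms unfolding poly_growth_def by blast
  have "0 \<le> C" using order_trans[OF abs_ge_zero *[of "\<lambda>_. 0"]] by simp
  then show ?thesis using * that by blast
qed

lemma poly_growthI:
  "continuous_on UNIV F \<Longrightarrow> (\<And>y. \<bar>F y\<bar> \<le> C * (1 + (\<Sum>i<n. \<bar>y i\<bar>)) ^ m) \<Longrightarrow> poly_growth F"
  unfolding poly_growth_def by blast

lemma poly_growth_continuous: "poly_growth F \<Longrightarrow> continuous_on UNIV F"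
  by (simp add: poly_growth_def)

lemma coordinate_sum_mono: "(n::nat) \<le> k \<Longrightarrow> (\<Sum>i<n. \<bar>y i :: real\<bar>) \<le> (\<Sum>i<k. \<bar>y i\<bar>)"
  by (intro sum_mono2) auto

text \<open>Brings two growth bounds to common n and m, so that sums and products can be estimated
  directly.\<close>

lemma poly_growth_widen:
  fixes y :: "nat \<Rightarrow> real"
  assumes "\<And>y :: nat \<Rightarrow> real. \<bar>F y\<bar> \<le> C * (1 + (\<Sum>i<n. \<bar>y i\<bar>)) ^ m" "0 \<le> C" "n \<le> n'" "m \<le> m'"
  shows "\<bar>F y\<bar> \<le> C * (1 + (\<Sum>i<n'. \<bar>y i :: real\<bar>)) ^ m'"
proof -
  have "\<bar>F y\<bar> \<le> C * (1 + (\<Sum>i<n. \<bar>y i\<bar>)) ^ m" by (rule assms)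
  also have "\<dots> \<le> C * (1 + (\<Sum>i<n'. \<bar>y i\<bar>)) ^ m"
    using assms coordinate_sum_mono[of n n' y]
    by (intro mult_left_mono power_mono) (auto intro!: sum_nonneg add_nonneg_nonneg)
  also have "\<dots> \<le> C * (1 + (\<Sum>i<n'. \<bar>y i\<bar>)) ^ m'"
    using assms by (intro mult_left_mono power_increasing) (auto intro!: sum_nonneg)
  finally show ?thesis .
qed

lemma poly_growth_const: "poly_growth (\<lambda>_. c)"
  by (rule poly_growthI[of _ "\<bar>c\<bar>" 0 0]) auto

lemma poly_growth_coordinate: "poly_growth (\<lambda>y. y k)"
proof (rule poly_growthI[of _ 1 "Suc k" 1])
  fix y :: "nat \<Rightarrow> real"
  have "\<bar>y k\<bar> \<le> (\<Sum>i<Suc k. \<bar>y i\<bar>)" by (rule member_le_sum) auto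
  then show "\<bar>y k\<bar> \<le> 1 * (1 + (\<Sum>i<Suc k. \<bar>y i\<bar>)) ^ 1" by simp
qed (rule continuous_on_product_coordinates)

lemma poly_growth_add:
  assumes "poly_growth F" "poly_growth G" shows "poly_growth (\<lambda>y. F y + G y)"
proof -
  obtain n C m where F: "0 \<le> C" "\<And>y. \<bar>F y\<bar> \<le> C * (1 + (\<Sum>i<n. \<bar>y i\<bar>)) ^ m" by (rule poly_growthE[OF assms(1)]) blast
  obtain n' D m' where G: "0 \<le> D" "\<And>y. \<bar>G y\<bar> \<le> D * (1 + (\<Sum>i<n'. \<bar>y i\<bar>)) ^ m'" by (rule poly_growthE[OF assms(2)]) blast
  show ?thesis
  proof (rule poly_growthI)
    fix y
    have "\<bar>F y\<bar> \<le> C * (1 + (\<Sum>i<max n n'. \<bar>y i\<bar>)) ^ max m m'"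
      by (rule poly_growth_widen[OF F(2)]) (use F in auto)
    moreover have "\<bar>G y\<bar> \<le> D * (1 + (\<Sum>i<max n n'. \<bar>y i\<bar>)) ^ max m m'"
      by (rule poly_growth_widen[OF G(2)]) (use G in auto)
    ultimately show "\<bar>F y + G y\<bar> \<le> (C + D) * (1 + (\<Sum>i<max n n'. \<bar>y i\<bar>)) ^ max m m'"
      unfolding distrib_right by linarith
  qed (intro continuous_intros poly_growth_continuous assms)
qed

lemma poly_growth_mult:
  assumes "poly_growth F" "poly_growth G" shows "poly_growth (\<lambda>y. F y * G y)"
proof -
  obtain n C m where F: "0 \<le> C" "\<And>y. \<bar>F y\<bar> \<le> C * (1 + (\<Sum>i<n. \<bar>y i\<bar>)) ^ m" by (rule poly_growthE[OF assms(1)]) blast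
  obtain n' D m' where G: "0 \<le> D" "\<And>y. \<bar>G y\<bar> \<le> D * (1 + (\<Sum>i<n'. \<bar>y i\<bar>)) ^ m'" by (rule poly_growthE[OF assms(2)]) blast
  show ?thesis
  proof (rule poly_growthI)
    fix y
    have "\<bar>F y\<bar> \<le> C * (1 + (\<Sum>i<max n n'. \<bar>y i\<bar>)) ^ m"
      by (rule poly_growth_widen[OF F(2)]) (use F in auto)
    moreover have "\<bar>G y\<bar> \<le> D * (1 + (\<Sum>i<max n n'. \<bar>y i\<bar>)) ^ m'"
      by (rule poly_growth_widen[OF G(2)]) (use G in auto)
    ultimately have "\<bar>F y\<bar> * \<bar>G y\<bar> \<le> (C * (1 + (\<Sum>i<max n n'. \<bar>y i\<bar>)) ^ m) * (D * (1 + (\<Sum>i<max n n'. \<bar>y i\<bar>)) ^ m')"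
      by (rule mult_mono) (use F in \<open>auto intro!: mult_nonneg_nonneg zero_le_power add_nonneg_nonneg sum_nonneg\<close>)
    then show "\<bar>F y * G y\<bar> \<le> (C * D) * (1 + (\<Sum>i<max n n'. \<bar>y i\<bar>)) ^ (m + m')"
      by (simp add: abs_mult power_add ac_simps)
  qed (intro continuous_intros poly_growth_continuous assms)
qed

lemma poly_growth_diff:
  assumes "poly_growth F" "poly_growth G" shows "poly_growth (\<lambda>y. F y - G y)"
  using poly_growth_add[OF assms(1) poly_growth_mult[OF poly_growth_const assms(2), of "-1"]] by simp

lemma poly_growth_sum:
  assumes "\<And>i. i \<in> A \<Longrightarrow> poly_growth (F i)" shows "poly_growth (\<lambda>y. \<Sum>i\<in>A. F i y)"
  using assms by (induction A rule: infinite_finite_induct) (simp_all add: poly_growth_const poly_growth_add)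

lemma poly_growth_power: "poly_growth F \<Longrightarrow> poly_growth (\<lambda>y. F y ^ m)"
  by (induction m) (simp_all add: poly_growth_const poly_growth_mult)

lemma poly_growth_measurable: "poly_growth F \<Longrightarrow> F \<in> borel_measurable wiener"
  unfolding borel_measurable_wiener_iff
  by (intro borel_measurable_continuous_onI poly_growth_continuous)

lemma poly_growth_integrable:
  assumes "poly_growth F" shows "integrable wiener F"
proof -
  obtain n C m where C: "0 \<le> C" "\<And>y. \<bar>F y\<bar> \<le> C * (1 + (\<Sum>i<n. \<bar>y i\<bar>)) ^ m"
    by (rule poly_growthE[OF assms(1)]) blast
  show ?thesis
  proof (rule Bochner_Integration.integrable_bound)
    have "integrable wiener (\<lambda>y. \<bar>y i\<bar> ^ m)" for i
      by (subst integrable_coordinate) (auto intro: integrable_gauss_abs_power)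
    then show "integrable wiener (\<lambda>y. C * ((1 + real n) ^ m * (1 + (\<Sum>i<n. \<bar>y i\<bar> ^ m))))"
      by (intro integrable_mult_right Bochner_Integration.integrable_add Bochner_Integration.integrable_sum
          wiener.integrable_const)
    show "AE y in wiener. norm (F y) \<le> norm (C * ((1 + real n) ^ m * (1 + (\<Sum>i<n. \<bar>y i\<bar> ^ m))))"
    proof (rule AE_I2)
      fix y
      have "\<bar>F y\<bar> \<le> C * (1 + (\<Sum>i<n. \<bar>y i\<bar>)) ^ m" by (rule C)
      also have "\<dots> \<le> C * ((1 + real n) ^ m * (1 + (\<Sum>i<n. \<bar>y i\<bar> ^ m)))"
        using growth_bound_sum[of "{..<n}" "\<lambda>i. \<bar>y i\<bar>" m] C by (intro mult_left_mono) auto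
      also have "\<dots> \<le> norm \<dots>" by simp
      finally show "norm (F y) \<le> norm (C * ((1 + real n) ^ m * (1 + (\<Sum>i<n. \<bar>y i\<bar> ^ m))))" by simp
    qed
  qed (rule poly_growth_measurable[OF assms])
qed

lemma poly_growth_Lp:
  assumes "poly_growth F" "1 < p" shows "F \<in> Lp p"
proof -
  \<comment> \<open>Any integer m \<ge> p will do: |F|^p is at most 1 where |F| \<le> 1 and at most
    |F|^m elsewhere.\<close>
  obtain m :: nat where m: "p \<le> real m" using real_arch_simple by blast
  have "integrable wiener (\<lambda>\<omega>. \<bar>F \<omega>\<bar> powr p)"
  proof (rule Bochner_Integration.integrable_bound)
    have "integrable wiener (\<lambda>\<omega>. F \<omega> ^ m)" by (intro poly_growth_integrable poly_growth_power assms)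
    then show "integrable wiener (\<lambda>\<omega>. 1 + \<bar>F \<omega> ^ m\<bar>)" by simp
    show "(\<lambda>\<omega>. \<bar>F \<omega>\<bar> powr p) \<in> borel_measurable wiener"
      using poly_growth_measurable[OF assms(1)] by measurable
    have "\<bar>F \<omega>\<bar> powr p \<le> 1 + \<bar>F \<omega> ^ m\<bar>" for \<omega>
    proof (cases "\<bar>F \<omega>\<bar> \<le> 1")
      case True
      then have "\<bar>F \<omega>\<bar> powr p \<le> 1 powr p" using assms by (intro powr_mono2) auto
      then show ?thesis by simp
    next
      case False
      then have "\<bar>F \<omega>\<bar> powr p \<le> \<bar>F \<omega>\<bar> powr real m" using m by (intro powr_mono) auto
      also have "\<dots> = \<bar>F \<omega> ^ m\<bar>" using False by (subst powr_realpow) (auto simp: power_abs)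
      finally show ?thesis by simp
    qed
    then show "AE \<omega> in wiener. norm (\<bar>F \<omega>\<bar> powr p) \<le> norm (1 + \<bar>F \<omega> ^ m\<bar>)" by simp
  qed
  then show ?thesis using poly_growth_measurable[OF assms(1)] by (simp add: Lp_def)
qed

lemma continuous_fun_upd: "continuous_on UNIV (\<lambda>t. (y :: nat \<Rightarrow> real)(k := t))"
proof (rule continuous_on_coordinatewise_then_product)
  show "continuous_on UNIV (\<lambda>t. (y(k := t)) i)" for i
    by (cases "i = k") auto
qed

lemma poly_growth_section:
  assumes "poly_growth F"
  shows "poly_bounded (\<lambda>t. F (y(k := t)))" "continuous_on UNIV (\<lambda>t. F (y(k := t)))"
proof -
  obtain n C m where C: "0 \<le> C" "\<And>y. \<bar>F y\<bar> \<le> C * (1 + (\<Sum>i<n. \<bar>y i\<bar>)) ^ m"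
    by (rule poly_growthE[OF assms(1)]) blast
  show "poly_bounded (\<lambda>t. F (y(k := t)))"
  proof (rule poly_boundedI)
    fix t
    let ?s = "\<Sum>i<n. \<bar>y i\<bar>"
    have s: "0 \<le> ?s" by (intro sum_nonneg) auto
    have "(\<Sum>i<n. \<bar>(y(k := t)) i\<bar>) \<le> (\<Sum>i<n. \<bar>y i\<bar> + (if i = k then \<bar>t\<bar> else 0))"
      by (intro sum_mono) auto
    also have "\<dots> \<le> ?s + \<bar>t\<bar>" by (simp add: sum.distrib)
    finally have "(\<Sum>i<n. \<bar>(y(k := t)) i\<bar>) \<le> ?s + \<bar>t\<bar>" .
    moreover have "(1 + ?s) * (1 + \<bar>t\<bar>) = 1 + ?s + \<bar>t\<bar> + ?s * \<bar>t\<bar>"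
      by (simp add: algebra_simps)
    ultimately have "1 + (\<Sum>i<n. \<bar>(y(k := t)) i\<bar>) \<le> (1 + ?s) * (1 + \<bar>t\<bar>)"
      using mult_nonneg_nonneg[OF s abs_ge_zero[of t]] by linarith
    then have "(1 + (\<Sum>i<n. \<bar>(y(k := t)) i\<bar>)) ^ m \<le> ((1 + ?s) * (1 + \<bar>t\<bar>)) ^ m"
      by (intro power_mono) (auto intro!: add_nonneg_nonneg sum_nonneg)
    then have "C * (1 + (\<Sum>i<n. \<bar>(y(k := t)) i\<bar>)) ^ m \<le> C * ((1 + ?s) * (1 + \<bar>t\<bar>)) ^ m"
      using C by (intro mult_left_mono)
    with C(2)[of "y(k := t)"] show "\<bar>F (y(k := t))\<bar> \<le> (C * (1 + ?s) ^ m) * (1 + \<bar>t\<bar>) ^ m"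
      by (simp add: power_mult_distrib)
  qed
  show "continuous_on UNIV (\<lambda>t. F (y(k := t)))"
    by (rule continuous_on_compose2[OF poly_growth_continuous[OF assms] continuous_fun_upd]) auto
qed

text \<open>Stein's identity on each line in direction \<open>k\<close>, averaged over the other
  coordinates by resampling coordinate \<open>k\<close>.\<close>

lemma wiener_integration_by_parts:
  assumes F: "poly_growth F" and F': "poly_growth F'"
    and d: "\<And>y. ((\<lambda>t. F (y(k := t))) has_real_derivative F' y) (at (y k))"
  shows "(\<integral>y. F' y \<partial>wiener) = (\<integral>y. y k * F y \<partial>wiener)"
proof -
  have d': "((\<lambda>t. F (y(k := t))) has_real_derivative F' (y(k := x))) (at x)" for x y
    using d[of "y(k := x)"] by simp
  have "(\<integral>y. F' y \<partial>wiener) = (\<integral>y. (\<integral>x. F' (y(k := x)) \<partial>gauss) \<partial>wiener)"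
    by (rule integral_resample[symmetric, OF poly_growth_integrable[OF F']])
  also have "\<dots> = (\<integral>y. (\<integral>x. x * F (y(k := x)) \<partial>gauss) \<partial>wiener)"
    by (intro Bochner_Integration.integral_cong refl gauss_integration_by_parts d' poly_growth_section F F')
  also have "\<dots> = (\<integral>y. (\<integral>x. (y(k := x)) k * F (y(k := x)) \<partial>gauss) \<partial>wiener)"
    by simp
  also have "\<dots> = (\<integral>y. y k * F y \<partial>wiener)"
    by (rule integral_resample, rule poly_growth_integrable) (intro poly_growth_mult poly_growth_coordinate F)
  finally show ?thesis .
qed

section \<open>Calculus of smooth cylindrical functions\<close>

definition depends_on_first :: "nat \<Rightarrow> ((nat \<Rightarrow> real) \<Rightarrow> real) \<Rightarrow> bool" where
  "depends_on_first n F \<longleftrightarrow> (\<forall>y z. (\<forall>i<n. y i = z i) \<longrightarrow> F y = F z)"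

lemma partial_eq_0:
  assumes "depends_on_first n F" "n \<le> k" shows "partial k F = (\<lambda>_. 0)"
proof
  fix y
  have "(\<lambda>t. F (y(k := t))) = (\<lambda>_. F y)"
    using assms unfolding depends_on_first_def by fastforce
  then show "partial k F y = 0" by (simp add: partial_def)
qed

lemma depends_on_first_partial:
  assumes "depends_on_first n F" shows "depends_on_first n (partial k F)"
proof (cases "k < n")
  case True
  show ?thesis
    unfolding depends_on_first_def
  proof (intro allI impI)
    fix y z :: "nat \<Rightarrow> real" assume yz: "\<forall>i<n. y i = z i"
    then have "(\<lambda>t. F (y(k := t))) = (\<lambda>t. F (z(k := t)))"
      using assms unfolding depends_on_first_def by fastforce
    then show "partial k F y = partial k F z" using yz True by (simp add: partial_def)
  qed
next
  case False
  then show ?thesis using partial_eq_0[OF assms] by (simp add: depends_on_first_def)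
qed

lemma depends_on_first_mono: "depends_on_first n F \<Longrightarrow> n \<le> m \<Longrightarrow> depends_on_first m F"
  unfolding depends_on_first_def by (meson order_less_le_trans)

definition coordinate_differentiable :: "((nat \<Rightarrow> real) \<Rightarrow> real) \<Rightarrow> bool" where
  "coordinate_differentiable F \<longleftrightarrow> (\<forall>k y. (\<lambda>t. F (y(k := t))) differentiable (at (y k)))"

lemma has_partial:
  "coordinate_differentiable F \<Longrightarrow>
    ((\<lambda>t. F (y(k := t))) has_real_derivative partial k F y) (at (y k))"
  unfolding coordinate_differentiable_def partial_def
  by (metis DERIV_deriv_iff_real_differentiable)

lemma partial_eqI:
  "((\<lambda>t. F (y(k := t))) has_real_derivative d) (at (y k)) \<Longrightarrow> partial k F y = d"
  unfolding partial_def by (rule DERIV_imp_deriv)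

text \<open>The definition uses one n both for the dependence of F and for all growth bounds.
  Decoupling the two makes the closure rules of \<open>poly_growth\<close> available.\<close>

lemma smooth_cylindrical_iff:
  "smooth_cylindrical F \<longleftrightarrow> (\<exists>n. depends_on_first n F) \<and>
    (\<forall>ks. poly_growth (foldr partial ks F) \<and> coordinate_differentiable (foldr partial ks F))"
  (is "?L \<longleftrightarrow> ?R")
proof
  assume ?L
  then show ?R
    unfolding smooth_cylindrical_def depends_on_first_def poly_growth_def
      coordinate_differentiable_def Let_def by blast
next
  assume R: ?R
  then obtain n where n: "depends_on_first n F" by blast
  show ?L
    unfolding smooth_cylindrical_def Let_def
  proof (intro exI[of _ n] conjI allI)
    show "(\<forall>i<n. y i = z i) \<longrightarrow> F y = F z" for y z
      using n by (simp add: depends_on_first_def)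
    fix ks
    let ?D = "foldr partial ks F"
    show "continuous_on UNIV ?D" using R by (simp add: poly_growth_def)
    show "(\<lambda>t. ?D (y(k := t))) differentiable at (y k)" for k y
      using R by (simp add: coordinate_differentiable_def)
    have "poly_growth ?D" using R by blast
    then obtain m C l where C: "0 \<le> C" "\<And>y. \<bar>?D y\<bar> \<le> C * (1 + (\<Sum>i<m. \<bar>y i\<bar>)) ^ l"
      by (rule poly_growthE) blast
    have D: "depends_on_first n ?D"
      by (induction ks) (simp_all add: n depends_on_first_partial)
    show "\<exists>C l. \<forall>y. \<bar>?D y\<bar> \<le> C * (1 + (\<Sum>i<n. \<bar>y i\<bar>)) ^ l"
    proof (intro exI allI)
      fix y :: "nat \<Rightarrow> real"
      \<comment> \<open>Zeroing the coordinates from n on leaves the value of \<open>?D\<close>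
        unchanged, and the bound at z involves the first n coordinates only.\<close>
      define z where "z i = (if i < n then y i else 0)" for i
      have "(\<Sum>i<m. \<bar>z i\<bar>) \<le> (\<Sum>i<max n m. \<bar>z i\<bar>)" by (rule coordinate_sum_mono) simp
      also have "\<dots> = (\<Sum>i<n. \<bar>y i\<bar>)"
        by (rule sum.mono_neutral_cong_right) (auto simp: z_def)
      finally have s: "(\<Sum>i<m. \<bar>z i\<bar>) \<le> (\<Sum>i<n. \<bar>y i\<bar>)" .
      have "?D y = ?D z" using D unfolding depends_on_first_def z_def by simp
      also have "\<bar>\<dots>\<bar> \<le> C * (1 + (\<Sum>i<m. \<bar>z i\<bar>)) ^ l" by (rule C)
      also have "\<dots> \<le> C * (1 + (\<Sum>i<n. \<bar>y i\<bar>)) ^ l"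
        using C s by (intro mult_left_mono power_mono) (auto intro!: sum_nonneg add_nonneg_nonneg)
      finally show "\<bar>?D y\<bar> \<le> C * (1 + (\<Sum>i<n. \<bar>y i\<bar>)) ^ l" .
    qed
  qed
qed

lemma smooth_cylindrical_poly_growth: "smooth_cylindrical F \<Longrightarrow> poly_growth F"
  unfolding smooth_cylindrical_iff by (metis foldr.simps(1) id_apply)

lemma smooth_cylindrical_differentiable: "smooth_cylindrical F \<Longrightarrow> coordinate_differentiable F"
  unfolding smooth_cylindrical_iff by (metis foldr.simps(1) id_apply)

lemma smooth_cylindrical_partial:
  assumes "smooth_cylindrical F" shows "smooth_cylindrical (partial k F)"
proof -
  have "poly_growth (foldr partial ks (partial k F)) \<and>
      coordinate_differentiable (foldr partial ks (partial k F))" for ks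
  proof -
    \<comment> \<open>\<open>foldr\<close> applies the last list entry first, so the extra
      derivative goes to the end of the list.\<close>
    have "foldr partial ks (partial k F) = foldr partial (ks @ [k]) F" by simp
    then show ?thesis using assms unfolding smooth_cylindrical_iff by metis
  qed
  then show ?thesis
    using assms depends_on_first_partial unfolding smooth_cylindrical_iff by blast
qed

lemma partial_diff:
  assumes "coordinate_differentiable F" "coordinate_differentiable G"
  shows "partial k (\<lambda>y. F y - G y) = (\<lambda>y. partial k F y - partial k G y)"
  by (rule ext, rule partial_eqI) (intro DERIV_diff has_partial assms)

lemma smooth_cylindrical_diff:
  assumes F: "smooth_cylindrical F" and G: "smooth_cylindrical G"
  shows "smooth_cylindrical (\<lambda>y. F y - G y)"
proof -
  obtain n m where "depends_on_first n F" "depends_on_first m G"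
    using F G unfolding smooth_cylindrical_iff by blast
  then have "depends_on_first (max n m) F" "depends_on_first (max n m) G"
    by (auto elim: depends_on_first_mono)
  then have dep: "depends_on_first (max n m) (\<lambda>y. F y - G y)"
    unfolding depends_on_first_def by metis
  have d: "coordinate_differentiable (foldr partial ks F)" "coordinate_differentiable (foldr partial ks G)"
    and g: "poly_growth (foldr partial ks F)" "poly_growth (foldr partial ks G)" for ks
    using F G unfolding smooth_cylindrical_iff by blast+
  have "foldr partial ks (\<lambda>y. F y - G y) = (\<lambda>y. foldr partial ks F y - foldr partial ks G y)" for ks
    by (induction ks) (simp_all add: partial_diff d)
  moreover have "coordinate_differentiable (\<lambda>y. foldr partial ks F y - foldr partial ks G y)" for ks
    using d[of ks] unfolding coordinate_differentiable_def by (auto intro: differentiable_diff)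
  ultimately show ?thesis
    unfolding smooth_cylindrical_iff using dep g by (auto intro!: poly_growth_diff)
qed

text \<open>Knowing the dependence of one argument is enough, as every term from n on has a
  vanishing factor. The other argument may then range over functionals of differently many
  coordinates.\<close>

lemma cyl_gamma_eq_sum:
  assumes "depends_on_first n R"
  shows "cyl_gamma F R y = (\<Sum>k<n. partial k F y * partial k R y)"
  unfolding cyl_gamma_def
  by (rule suminf_finite) (use partial_eq_0[OF assms] in auto)

lemma cyl_gamma_commute: "cyl_gamma F R = cyl_gamma R F"
  by (rule ext) (simp add: cyl_gamma_def mult.commute)

lemma common_dependence:
  assumes "smooth_cylindrical F" "smooth_cylindrical G"
  obtains n where "depends_on_first n F" "depends_on_first n G"
proof -
  obtain n m where "depends_on_first n F" "depends_on_first m G"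
    using assms unfolding smooth_cylindrical_iff by blast
  then have "depends_on_first (max n m) F" "depends_on_first (max n m) G"
    by (auto elim: depends_on_first_mono)
  then show ?thesis by (rule that)
qed

lemma poly_growth_cyl_gamma:
  assumes "smooth_cylindrical F" "smooth_cylindrical R" shows "poly_growth (cyl_gamma F R)"
proof -
  obtain n where n: "depends_on_first n R" using assms unfolding smooth_cylindrical_iff by blast
  have "poly_growth (\<lambda>y. \<Sum>k<n. partial k F y * partial k R y)"
    by (intro poly_growth_sum poly_growth_mult smooth_cylindrical_poly_growth smooth_cylindrical_partial assms)
  then show ?thesis using cyl_gamma_eq_sum[OF n] by presburger
qed

lemma cyl_gamma_diff_left:
  assumes "smooth_cylindrical F" "smooth_cylindrical G" "smooth_cylindrical R"
  shows "cyl_gamma (\<lambda>y. F y - G y) R y = cyl_gamma F R y - cyl_gamma G R y"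
proof -
  obtain n where n: "depends_on_first n R" using assms unfolding smooth_cylindrical_iff by blast
  show ?thesis
    using assms by (simp add: cyl_gamma_eq_sum[OF n] partial_diff smooth_cylindrical_differentiable
        sum_subtractf left_diff_distrib)
qed

lemma cyl_gamma_nonneg:
  assumes "smooth_cylindrical F" shows "0 \<le> cyl_gamma F F y"
proof -
  obtain n where n: "depends_on_first n F" using assms unfolding smooth_cylindrical_iff by blast
  show ?thesis by (simp add: cyl_gamma_eq_sum[OF n] sum_nonneg)
qed

text \<open>The classical form of L, Laplacian minus y times gradient, cut at n. On functionals of
  the first n coordinates the omitted terms vanish.\<close>

definition ornstein_uhlenbeck :: "nat \<Rightarrow> ((nat \<Rightarrow> real) \<Rightarrow> real) \<Rightarrow> (nat \<Rightarrow> real) \<Rightarrow> real" where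
  "ornstein_uhlenbeck n R y = (\<Sum>k<n. partial k (partial k R) y - y k * partial k R y)"

lemma poly_growth_ornstein_uhlenbeck:
  "smooth_cylindrical R \<Longrightarrow> poly_growth (ornstein_uhlenbeck n R)"
  unfolding ornstein_uhlenbeck_def[abs_def]
  by (intro poly_growth_sum poly_growth_diff poly_growth_mult poly_growth_coordinate
      smooth_cylindrical_poly_growth smooth_cylindrical_partial)

text \<open>For each k, the product of F and \<open>partial k R\<close> is integrated by parts in
  direction k. Since n bounds the dependence of R alone, one operator serves for all test
  functionals F.\<close>

lemma integral_cyl_gamma:
  assumes F: "smooth_cylindrical F" and R: "smooth_cylindrical R" and n: "depends_on_first n R"
  shows "(\<integral>y. cyl_gamma F R y \<partial>wiener) = - (\<integral>y. F y * ornstein_uhlenbeck n R y \<partial>wiener)"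
proof -
  note growth = smooth_cylindrical_poly_growth smooth_cylindrical_partial
    poly_growth_diff poly_growth_add poly_growth_mult poly_growth_coordinate
  have k: "(\<integral>y. partial k F y * partial k R y \<partial>wiener) =
      (\<integral>y. F y * (y k * partial k R y - partial k (partial k R) y) \<partial>wiener)" for k
  proof -
    have 1: "integrable wiener (\<lambda>y. partial k F y * partial k R y)"
      by (intro poly_growth_integrable growth F R)
    have 2: "integrable wiener (\<lambda>y. F y * partial k (partial k R) y)"
      by (intro poly_growth_integrable growth F R)
    have 3: "integrable wiener (\<lambda>y. y k * (F y * partial k R y))"
      by (intro poly_growth_integrable growth F R)
    have "(\<integral>y. partial k F y * partial k R y + F y * partial k (partial k R) y \<partial>wiener) =
        (\<integral>y. y k * (F y * partial k R y) \<partial>wiener)"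
    proof (rule wiener_integration_by_parts)
      fix y
      show "((\<lambda>t. F (y(k := t)) * partial k R (y(k := t))) has_real_derivative
          partial k F y * partial k R y + F y * partial k (partial k R) y) (at (y k))"
        using DERIV_mult[OF has_partial[OF smooth_cylindrical_differentiable[OF F]]
          has_partial[OF smooth_cylindrical_differentiable[OF smooth_cylindrical_partial[OF R]]], of y k y k k]
        by (simp add: mult.commute add.commute)
    qed (intro growth F R)+
    then have "(\<integral>y. partial k F y * partial k R y \<partial>wiener) =
        (\<integral>y. y k * (F y * partial k R y) \<partial>wiener) - (\<integral>y. F y * partial k (partial k R) y \<partial>wiener)"
      using 1 2 by simp
    also have "\<dots> = (\<integral>y. y k * (F y * partial k R y) - F y * partial k (partial k R) y \<partial>wiener)"
      using 2 3 by simp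
    finally show ?thesis by (simp add: algebra_simps)
  qed
  have "(\<integral>y. cyl_gamma F R y \<partial>wiener) = (\<Sum>k<n. \<integral>y. partial k F y * partial k R y \<partial>wiener)"
    unfolding cyl_gamma_eq_sum[OF n]
    by (rule Bochner_Integration.integral_sum) (intro poly_growth_integrable growth F R)
  also have "\<dots> = (\<Sum>k<n. \<integral>y. F y * (y k * partial k R y - partial k (partial k R) y) \<partial>wiener)"
    by (simp only: k)
  also have "\<dots> = (\<integral>y. (\<Sum>k<n. F y * (y k * partial k R y - partial k (partial k R) y)) \<partial>wiener)"
    by (rule Bochner_Integration.integral_sum[symmetric]) (intro poly_growth_integrable growth F R)
  also have "\<dots> = (\<integral>y. - (F y * ornstein_uhlenbeck n R y) \<partial>wiener)"
    by (rule Bochner_Integration.integral_cong)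
      (simp_all add: ornstein_uhlenbeck_def sum_distrib_left sum_negf[symmetric] algebra_simps)
  finally show ?thesis by simp
qed

section \<open>The generator on smooth cylindrical functions\<close>

text \<open>Passes from Young's inequality with a free parameter c to Cauchy-Schwarz by optimizing
  over c. Stated for plain numbers, it serves both the L^2 product and the energy form.\<close>

lemma le_sqrt_mult_sqrt:
  fixes x p q :: real
  assumes b: "\<And>c. 0 < c \<Longrightarrow> 2 * x \<le> c * q + p / c" and p: "0 \<le> p" and q: "0 \<le> q"
  shows "x \<le> sqrt q * sqrt p"
proof (rule ccontr)
  assume "\<not> x \<le> sqrt q * sqrt p"
  then have x: "sqrt q * sqrt p < x" by simp
  then have x0: "0 < x" using p q by (smt (verit) mult_nonneg_nonneg real_sqrt_ge_zero)
  consider "p = 0" | "q = 0" | "0 < p" "0 < q" using p q by force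
  then show False
  proof cases
    case 1
    \<comment> \<open>There is no minimizer here; c is taken so small that c q stays below x, and
      the added 1 prevents a division by zero.\<close>
    have "2 * x \<le> x / (q + 1) * q" using b[of "x / (q + 1)"] x0 q 1 by simp
    also have "\<dots> \<le> x" using x0 q by (simp add: field_simps)
    finally show False using x0 by simp
  next
    case 2
    have "2 * x \<le> p / ((p + 1) / x)" using b[of "(p + 1) / x"] x0 p 2 by simp
    also have "\<dots> \<le> x" using x0 p by (simp add: field_simps)
    finally show False using x0 by simp
  next
    case 3
    \<comment> \<open>The minimizer c = sqrt p / sqrt q makes the two terms equal.\<close>
    have "sqrt p / sqrt q * q = sqrt p * sqrt q" "p / (sqrt p / sqrt q) = sqrt p * sqrt q"
      using 3 by (simp_all add: field_simps)
    then show False using b[of "sqrt p / sqrt q"] 3 x by (simp add: mult.commute)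
  qed
qed

lemma two_abs_mult_le:
  fixes a b c :: real
  assumes "0 < c" shows "2 * \<bar>a * b\<bar> \<le> c * a\<^sup>2 + b\<^sup>2 / c"
proof -
  have "0 \<le> (sqrt c * \<bar>a\<bar> - \<bar>b\<bar> / sqrt c)\<^sup>2" by simp
  also have "\<dots> = c * a\<^sup>2 + b\<^sup>2 / c - 2 * (\<bar>a\<bar> * \<bar>b\<bar>)"
    using assms by (simp add: power2_diff power_mult_distrib power_divide)
  finally show ?thesis by (simp add: abs_mult)
qed

lemma Cauchy_Schwarz_integral:
  fixes f g :: "'a \<Rightarrow> real"
  assumes [measurable]: "f \<in> borel_measurable M" "g \<in> borel_measurable M"
    and f: "integrable M (\<lambda>x. (f x)\<^sup>2)" and g: "integrable M (\<lambda>x. (g x)\<^sup>2)"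
  shows "integrable M (\<lambda>x. f x * g x)"
    and "\<bar>\<integral>x. f x * g x \<partial>M\<bar> \<le> sqrt (\<integral>x. (f x)\<^sup>2 \<partial>M) * sqrt (\<integral>x. (g x)\<^sup>2 \<partial>M)"
proof -
  show i: "integrable M (\<lambda>x. f x * g x)"
  proof (rule Bochner_Integration.integrable_bound)
    show "integrable M (\<lambda>x. (f x)\<^sup>2 + (g x)\<^sup>2)" using f g by simp
    have "\<bar>f x * g x\<bar> \<le> (f x)\<^sup>2 + (g x)\<^sup>2" for x
      using two_abs_mult_le[of 1 "f x" "g x"] zero_le_power2[of "f x"] zero_le_power2[of "g x"] by simp
    then show "AE x in M. norm (f x * g x) \<le> norm ((f x)\<^sup>2 + (g x)\<^sup>2)" by simp
  qed simp
  show "\<bar>\<integral>x. f x * g x \<partial>M\<bar> \<le> sqrt (\<integral>x. (f x)\<^sup>2 \<partial>M) * sqrt (\<integral>x. (g x)\<^sup>2 \<partial>M)"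
  proof (rule le_sqrt_mult_sqrt)
    fix c :: real assume c: "0 < c"
    have "2 * \<bar>\<integral>x. f x * g x \<partial>M\<bar> \<le> 2 * (\<integral>x. \<bar>f x * g x\<bar> \<partial>M)"
      by (intro mult_left_mono integral_abs_bound) auto
    also have "\<dots> = (\<integral>x. 2 * \<bar>f x * g x\<bar> \<partial>M)" by simp
    also have "\<dots> \<le> (\<integral>x. c * (f x)\<^sup>2 + (g x)\<^sup>2 / c \<partial>M)"
      using i f g c by (intro integral_mono two_abs_mult_le) auto
    also have "\<dots> = c * (\<integral>x. (f x)\<^sup>2 \<partial>M) + (\<integral>x. (g x)\<^sup>2 \<partial>M) / c"
      using f g by simp
    finally show "2 * \<bar>\<integral>x. f x * g x \<partial>M\<bar> \<le> c * (\<integral>x. (f x)\<^sup>2 \<partial>M) + (\<integral>x. (g x)\<^sup>2 \<partial>M) / c" .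
  qed auto
qed

section \<open>The energy form on smooth cylindrical functionals and its closability\<close>

definition energy :: "((nat \<Rightarrow> real) \<Rightarrow> real) \<Rightarrow> ((nat \<Rightarrow> real) \<Rightarrow> real) \<Rightarrow> real" where
  "energy F R = (\<integral>y. cyl_gamma F R y \<partial>wiener)"

lemma integrable_cyl_gamma:
  "smooth_cylindrical F \<Longrightarrow> smooth_cylindrical R \<Longrightarrow> integrable wiener (cyl_gamma F R)"
  by (intro poly_growth_integrable poly_growth_cyl_gamma)

lemma energy_nonneg: "smooth_cylindrical F \<Longrightarrow> 0 \<le> energy F F"
  unfolding energy_def by (intro integral_nonneg_AE AE_I2 cyl_gamma_nonneg)

lemma energy_commute: "energy F R = energy R F"
  unfolding energy_def by (simp add: cyl_gamma_commute)

lemma energy_diff_left: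
  "smooth_cylindrical F \<Longrightarrow> smooth_cylindrical G \<Longrightarrow> smooth_cylindrical R \<Longrightarrow>
    energy (\<lambda>y. F y - G y) R = energy F R - energy G R"
  unfolding energy_def
  by (subst Bochner_Integration.integral_diff[symmetric])
    (auto intro!: integrable_cyl_gamma Bochner_Integration.integral_cong simp: cyl_gamma_diff_left)

text \<open>Young's inequality is applied to each pair of partial derivatives with the same c, then
  summed and integrated; c is optimized only at the end.\<close>

lemma energy_Cauchy_Schwarz:
  assumes F: "smooth_cylindrical F" and R: "smooth_cylindrical R"
  shows "\<bar>energy F R\<bar> \<le> sqrt (energy F F) * sqrt (energy R R)"
proof (rule le_sqrt_mult_sqrt)
  fix c :: real assume c: "0 < c"
  obtain n where n: "depends_on_first n F" "depends_on_first n R"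
    using common_dependence[OF F R] .
  have b: "2 * \<bar>cyl_gamma F R y\<bar> \<le> c * cyl_gamma F F y + cyl_gamma R R y / c" for y
  proof -
    have "2 * \<bar>cyl_gamma F R y\<bar> \<le> 2 * (\<Sum>k<n. \<bar>partial k F y * partial k R y\<bar>)"
      unfolding cyl_gamma_eq_sum[OF n(2)] by (intro mult_left_mono sum_abs) auto
    also have "\<dots> \<le> (\<Sum>k<n. c * (partial k F y)\<^sup>2 + (partial k R y)\<^sup>2 / c)"
      unfolding sum_distrib_left by (intro sum_mono two_abs_mult_le c)
    finally show ?thesis
      by (simp add: cyl_gamma_eq_sum[OF n(1)] cyl_gamma_eq_sum[OF n(2)] sum.distrib
          sum_distrib_left sum_divide_distrib power2_eq_square)
  qed
  have "2 * \<bar>energy F R\<bar> \<le> 2 * (\<integral>y. \<bar>cyl_gamma F R y\<bar> \<partial>wiener)"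
    unfolding energy_def by (intro mult_left_mono integral_abs_bound) auto
  also have "\<dots> = (\<integral>y. 2 * \<bar>cyl_gamma F R y\<bar> \<partial>wiener)" by simp
  also have "\<dots> \<le> (\<integral>y. c * cyl_gamma F F y + cyl_gamma R R y / c \<partial>wiener)"
    using F R by (intro integral_mono b) (auto intro!: integrable_cyl_gamma)
  also have "\<dots> = c * energy F F + energy R R / c"
    using F R by (simp add: energy_def integrable_cyl_gamma)
  finally show "2 * \<bar>energy F R\<bar> \<le> c * energy F F + energy R R / c" .
qed (simp_all add: energy_nonneg F R)

lemma Lp_2_iff: "F \<in> Lp 2 \<longleftrightarrow> F \<in> borel_measurable wiener \<and> integrable wiener (\<lambda>\<omega>. (F \<omega>)\<^sup>2)"
proof -
  have "\<bar>x\<bar> powr 2 = x\<^sup>2" for x :: real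
    by (cases "x = 0") (simp_all add: powr_numeral)
  then show ?thesis by (simp add: Lp_def)
qed

lemma Lp_2_diff:
  assumes "F \<in> Lp 2" "G \<in> Lp 2" shows "(\<lambda>\<omega>. F \<omega> - G \<omega>) \<in> Lp 2"
proof -
  have [measurable]: "F \<in> borel_measurable wiener" "G \<in> borel_measurable wiener"
    and i: "integrable wiener (\<lambda>\<omega>. (F \<omega>)\<^sup>2)" "integrable wiener (\<lambda>\<omega>. (G \<omega>)\<^sup>2)"
    using assms by (auto simp: Lp_2_iff)
  have "integrable wiener (\<lambda>\<omega>. (F \<omega> - G \<omega>)\<^sup>2)"
    unfolding power2_diff using i Cauchy_Schwarz_integral(1)[OF _ _ i] by (simp add: mult.assoc)
  then show ?thesis by (simp add: Lp_2_iff)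
qed

text \<open>The definition speaks of \<open>ennreal\<close> integrals. All the integrands are
  integrable, so the same facts hold for real integrals, where linearity is available.\<close>

lemma energy_approxD:
  assumes "energy_approx S F"
  shows "F \<in> Lp 2" "smooth_cylindrical (S n)"
    "(\<lambda>n. \<integral>\<omega>. (S n \<omega> - F \<omega>)\<^sup>2 \<partial>wiener) \<longlonglongrightarrow> 0"
    "0 < e \<Longrightarrow> \<exists>M. \<forall>m\<ge>M. \<forall>n\<ge>M. energy (\<lambda>y. S m y - S n y) (\<lambda>y. S m y - S n y) < e"
proof -
  show F: "F \<in> Lp 2" and S: "\<And>n. smooth_cylindrical (S n)"
    using assms by (auto simp: energy_approx_def)
  have "integrable wiener (\<lambda>\<omega>. (S n \<omega> - F \<omega>)\<^sup>2)" for n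
    using Lp_2_diff[OF poly_growth_Lp[OF smooth_cylindrical_poly_growth[OF S]] F]
    by (simp add: Lp_2_iff)
  then have "(\<integral>\<^sup>+\<omega>. ennreal ((S n \<omega> - F \<omega>)\<^sup>2) \<partial>wiener) = ennreal (\<integral>\<omega>. (S n \<omega> - F \<omega>)\<^sup>2 \<partial>wiener)" for n
    by (intro nn_integral_eq_integral) auto
  then have "(\<lambda>n. ennreal (\<integral>\<omega>. (S n \<omega> - F \<omega>)\<^sup>2 \<partial>wiener)) \<longlonglongrightarrow> 0"
    using assms by (simp add: energy_approx_def)
  then show "(\<lambda>n. \<integral>\<omega>. (S n \<omega> - F \<omega>)\<^sup>2 \<partial>wiener) \<longlonglongrightarrow> 0"
    by (subst (asm) ennreal_tendsto_0_iff) auto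
  assume e: "0 < e"
  have D: "smooth_cylindrical (\<lambda>y. S m y - S n y)" for m n by (intro smooth_cylindrical_diff S)
  have "(\<integral>\<^sup>+\<omega>. ennreal (cyl_gamma (\<lambda>y. S m y - S n y) (\<lambda>y. S m y - S n y) \<omega>) \<partial>wiener)
      = ennreal (energy (\<lambda>y. S m y - S n y) (\<lambda>y. S m y - S n y))" for m n
    unfolding energy_def using D by (intro nn_integral_eq_integral integrable_cyl_gamma AE_I2 cyl_gamma_nonneg)
  then show "\<exists>M. \<forall>m\<ge>M. \<forall>n\<ge>M. energy (\<lambda>y. S m y - S n y) (\<lambda>y. S m y - S n y) < e"
    using assms e by (simp add: energy_approx_def ennreal_less_iff energy_nonneg D)
qed

lemma integral_mult_tendsto:
  assumes F: "F \<in> Lp 2" and S: "\<And>n. S n \<in> Lp 2" and H: "H \<in> Lp 2"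
    and lim: "(\<lambda>n. \<integral>\<omega>. (S n \<omega> - F \<omega>)\<^sup>2 \<partial>wiener) \<longlonglongrightarrow> 0"
  shows "(\<lambda>n. \<integral>\<omega>. S n \<omega> * H \<omega> \<partial>wiener) \<longlonglongrightarrow> (\<integral>\<omega>. F \<omega> * H \<omega> \<partial>wiener)"
proof (rule LIM_zero_cancel, rule Lim_null_comparison)
  let ?r = "\<lambda>n. sqrt (\<integral>\<omega>. (S n \<omega> - F \<omega>)\<^sup>2 \<partial>wiener) * sqrt (\<integral>\<omega>. (H \<omega>)\<^sup>2 \<partial>wiener)"
  have "(\<lambda>n. sqrt (\<integral>\<omega>. (S n \<omega> - F \<omega>)\<^sup>2 \<partial>wiener)) \<longlonglongrightarrow> sqrt 0" by (intro tendsto_real_sqrt lim)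
  then show "?r \<longlonglongrightarrow> 0" by (intro tendsto_mult_left_zero) simp
  have CS: "integrable wiener (\<lambda>\<omega>. P \<omega> * H \<omega>)" if "P \<in> Lp 2" for P
    using that H by (intro Cauchy_Schwarz_integral) (auto simp: Lp_2_iff)
  have "\<bar>(\<integral>\<omega>. S n \<omega> * H \<omega> \<partial>wiener) - (\<integral>\<omega>. F \<omega> * H \<omega> \<partial>wiener)\<bar> \<le> ?r n" for n
  proof -
    have "(\<integral>\<omega>. S n \<omega> * H \<omega> \<partial>wiener) - (\<integral>\<omega>. F \<omega> * H \<omega> \<partial>wiener) = (\<integral>\<omega>. (S n \<omega> - F \<omega>) * H \<omega> \<partial>wiener)"
      by (simp add: left_diff_distrib CS S F)
    also have "\<bar>\<dots>\<bar> \<le> ?r n"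
      using Lp_2_diff[OF S F] H by (intro Cauchy_Schwarz_integral) (auto simp: Lp_2_iff)
    finally show ?thesis .
  qed
  then show "\<forall>\<^sub>F n in sequentially.
      norm ((\<integral>\<omega>. S n \<omega> * H \<omega> \<partial>wiener) - (\<integral>\<omega>. F \<omega> * H \<omega> \<partial>wiener)) \<le> ?r n" by simp
qed

lemma energy_approx_bounded:
  assumes S: "energy_approx S F"
  obtains B where "\<And>n. energy (S n) (S n) \<le> B"
proof -
  note sm = energy_approxD(2)[OF S]
  obtain M where M: "\<And>m n. m \<ge> M \<Longrightarrow> n \<ge> M \<Longrightarrow> energy (\<lambda>y. S m y - S n y) (\<lambda>y. S m y - S n y) < 1"
    using energy_approxD(4)[OF S, of 1] by auto
  \<comment> \<open>Substitute for the triangle inequality of the energy seminorm: a^2 \<le> 2 (a -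
    b)^2 + 2 b^2, the difference of the two sides being (a - 2 b)^2.\<close>
  have *: "energy P P \<le> 2 * energy (\<lambda>y. P y - Q y) (\<lambda>y. P y - Q y) + 2 * energy Q Q"
    if P: "smooth_cylindrical P" and Q: "smooth_cylindrical Q" for P Q
  proof -
    have D: "smooth_cylindrical (\<lambda>y. P y - Q y)" by (intro smooth_cylindrical_diff P Q)
    obtain n where n: "depends_on_first n P" "depends_on_first n Q" using common_dependence[OF P Q] .
    then have nD: "depends_on_first n (\<lambda>y. P y - Q y)" unfolding depends_on_first_def by metis
    have pw: "cyl_gamma P P y \<le> 2 * cyl_gamma (\<lambda>y. P y - Q y) (\<lambda>y. P y - Q y) y + 2 * cyl_gamma Q Q y" for y
    proof -
      have "(partial k P y)\<^sup>2 \<le> 2 * (partial k P y - partial k Q y)\<^sup>2 + 2 * (partial k Q y)\<^sup>2" for k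
        using zero_le_power2[of "partial k P y - 2 * partial k Q y"] by (simp add: power2_eq_square algebra_simps)
      then have "(\<Sum>k<n. (partial k P y)\<^sup>2) \<le> (\<Sum>k<n. 2 * (partial k P y - partial k Q y)\<^sup>2 + 2 * (partial k Q y)\<^sup>2)"
        by (intro sum_mono)
      then show ?thesis
        by (simp add: cyl_gamma_eq_sum[OF n(1)] cyl_gamma_eq_sum[OF n(2)] cyl_gamma_eq_sum[OF nD] partial_diff
            smooth_cylindrical_differentiable P Q sum.distrib sum_distrib_left power2_eq_square)
    qed
    have "energy P P \<le> (\<integral>y. 2 * cyl_gamma (\<lambda>y. P y - Q y) (\<lambda>y. P y - Q y) y + 2 * cyl_gamma Q Q y \<partial>wiener)"
      unfolding energy_def using P Q D
      by (intro integral_mono pw integrable_cyl_gamma Bochner_Integration.integrable_add integrable_mult_right)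
    also have "\<dots> = 2 * energy (\<lambda>y. P y - Q y) (\<lambda>y. P y - Q y) + 2 * energy Q Q"
      using P Q D by (simp add: energy_def integrable_cyl_gamma)
    finally show ?thesis .
  qed
  \<comment> \<open>Beyond M every term is within energy 1 of \<open>S M\<close>; the finitely many
    earlier ones enter through the maximum.\<close>
  define B where "B = max (2 + 2 * energy (S M) (S M)) (Max ((\<lambda>n. energy (S n) (S n)) ` {..M}))"
  have "energy (S n) (S n) \<le> B" for n
  proof (cases "n \<le> M")
    case True
    then have "energy (S n) (S n) \<le> Max ((\<lambda>n. energy (S n) (S n)) ` {..M})" by (intro Max_ge) auto
    then show ?thesis by (simp add: B_def)
  next
    case False
    then show ?thesis using *[OF sm sm, of n M] M[of n M] by (simp add: B_def)
  qed
  then show ?thesis by (rule that)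
qed

text \<open>Closability of the form: an approximation of zero has vanishing energy against every other
  approximation, because one of its factors may be frozen and integrated by parts.\<close>

lemma energy_approx_zero:
  assumes S: "energy_approx S F" and U: "energy_approx U (\<lambda>_. 0)"
  shows "(\<lambda>n. energy (S n) (U n)) \<longlonglongrightarrow> 0"
proof -
  note sS = energy_approxD(2)[OF S] and sU = energy_approxD(2)[OF U]
  obtain B where B: "\<And>n. energy (U n) (U n) \<le> B" by (rule energy_approx_bounded[OF U]) blast
  have B0: "0 \<le> B" using order_trans[OF energy_nonneg[OF sU] B] .
  \<comment> \<open>With the first argument frozen at P, the energy is minus the integral of
    \<open>U n\<close> against a fixed element of L^2, and \<open>U n\<close> tends to 0 in
    L^2.\<close>
  have zero: "(\<lambda>n. energy P (U n)) \<longlonglongrightarrow> 0" if P: "smooth_cylindrical P" for P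
  proof -
    obtain m where m: "depends_on_first m P" using P unfolding smooth_cylindrical_iff by blast
    have "(\<lambda>n. \<integral>y. U n y * ornstein_uhlenbeck m P y \<partial>wiener) \<longlonglongrightarrow>
        (\<integral>y. 0 * ornstein_uhlenbeck m P y \<partial>wiener)"
      by (rule integral_mult_tendsto[OF energy_approxD(1)[OF U] _ _ energy_approxD(3)[OF U]])
        (rule poly_growth_Lp; simp add: poly_growth_ornstein_uhlenbeck P smooth_cylindrical_poly_growth sU)+
    moreover have "energy P (U n) = - (\<integral>y. U n y * ornstein_uhlenbeck m P y \<partial>wiener)" for n
      unfolding energy_commute[of P] unfolding energy_def by (rule integral_cyl_gamma[OF sU P m])
    ultimately show ?thesis using tendsto_minus by fastforce
  qed
  show ?thesis
  proof (rule LIMSEQ_I)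
    fix r :: real assume r: "0 < r"
    \<comment> \<open>Chosen so that \<open>sqrt d * sqrt B\<close> is at most r / 2; the added 1
      covers B = 0.\<close>
    define d where "d = (r / (2 * (sqrt B + 1)))\<^sup>2"
    have sB: "0 < sqrt B + 1" using B0 by (simp add: add_nonneg_pos)
    have d: "0 < d" "sqrt d = r / (2 * (sqrt B + 1))"
      using r sB B0 by (simp_all add: d_def)
    obtain M where M: "\<And>m n. m \<ge> M \<Longrightarrow> n \<ge> M \<Longrightarrow> energy (\<lambda>y. S m y - S n y) (\<lambda>y. S m y - S n y) < d"
      using energy_approxD(4)[OF S d(1)] by blast
    obtain K where K: "\<And>n. n \<ge> K \<Longrightarrow> \<bar>energy (S M) (U n)\<bar> < r / 2"
      using LIMSEQ_D[OF zero[OF sS[of M]], of "r / 2"] r by auto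
    show "\<exists>no. \<forall>n\<ge>no. norm (energy (S n) (U n) - 0) < r"
    proof (intro exI allI impI)
      fix n assume n: "max M K \<le> n"
      have "energy (S n) (U n) = energy (\<lambda>y. S n y - S M y) (U n) + energy (S M) (U n)"
        by (simp add: energy_diff_left sS sU)
      moreover have "\<bar>energy (\<lambda>y. S n y - S M y) (U n)\<bar> \<le> sqrt d * sqrt B"
      proof -
        have "\<bar>energy (\<lambda>y. S n y - S M y) (U n)\<bar>
            \<le> sqrt (energy (\<lambda>y. S n y - S M y) (\<lambda>y. S n y - S M y)) * sqrt (energy (U n) (U n))"
          by (intro energy_Cauchy_Schwarz smooth_cylindrical_diff sS sU)
        also have "\<dots> \<le> sqrt d * sqrt B"
          using M[of n M] n B[of n] real_sqrt_ge_zero[of d] d(1)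
          by (intro mult_mono real_sqrt_le_mono) (auto intro!: energy_nonneg sU)
        finally show ?thesis .
      qed
      moreover have "sqrt d * sqrt B \<le> r / 2"
        using r sB B0 unfolding d(2) by (simp add: field_simps)
      moreover have "\<bar>energy (S M) (U n)\<bar> < r / 2" using K n by simp
      ultimately show "norm (energy (S n) (U n) - 0) < r" by simp
    qed
  qed
qed

lemma zero_Lp_2: "(\<lambda>_. 0) \<in> Lp 2"
  by (simp add: Lp_2_iff)

lemma integrable_of_L1_limit:
  fixes f :: "nat \<Rightarrow> 'a \<Rightarrow> real"
  assumes f: "\<And>n. integrable M (f n)" and [measurable]: "g \<in> borel_measurable M"
    and lim: "(\<lambda>n. \<integral>\<^sup>+x. ennreal \<bar>f n x - g x\<bar> \<partial>M) \<longlonglongrightarrow> 0"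
  shows "integrable M g" "(\<lambda>n. \<integral>x. f n x \<partial>M) \<longlonglongrightarrow> (\<integral>x. g x \<partial>M)"
proof -
  have "\<forall>\<^sub>F n in sequentially. (\<integral>\<^sup>+x. ennreal \<bar>f n x - g x\<bar> \<partial>M) < \<infinity>"
    by (rule order_tendstoD(2)[OF lim]) simp
  then obtain n where n: "(\<integral>\<^sup>+x. ennreal \<bar>f n x - g x\<bar> \<partial>M) < \<infinity>"
    using eventually_happens' sequentially_bot by blast
  have [measurable]: "f n \<in> borel_measurable M" using f by auto
  have "integrable M (\<lambda>x. f n x - g x)" using n by (intro integrableI_bounded) auto
  then have "integrable M (\<lambda>x. f n x - (f n x - g x))" by (rule Bochner_Integration.integrable_diff[OF f])
  then show g: "integrable M g" by simp
  show "(\<lambda>n. \<integral>x. f n x \<partial>M) \<longlonglongrightarrow> (\<integral>x. g x \<partial>M)"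
    by (rule tendsto_L1_int) (use f g lim in auto)
qed

lemma energy_approx_const:
  assumes "smooth_cylindrical F" shows "energy_approx (\<lambda>_. F) F"
proof -
  have "cyl_gamma (\<lambda>_. 0) (\<lambda>_. 0) = (\<lambda>_. 0)"
    by (rule ext) (simp add: cyl_gamma_def partial_def)
  then show ?thesis
    unfolding energy_approx_def using assms
    by (simp add: poly_growth_Lp smooth_cylindrical_poly_growth)
qed

text \<open>The test allows arbitrary approximations \<open>S\<close> of F and \<open>T\<close> of
  R. In the splitting of \<open>T n\<close> into R and \<open>T n - R\<close>, the first part is
  integrated by parts and passes to the L^2 limit, while the second approximates zero and drops out
  by closability.\<close>

lemma is_generator_smooth_cylindrical:
  assumes R: "smooth_cylindrical R" and k: "depends_on_first k R"
  shows "is_generator R (ornstein_uhlenbeck k R)"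
proof -
  note sc = smooth_cylindrical_poly_growth
  let ?H = "ornstein_uhlenbeck k R"
  have HL: "?H \<in> Lp 2"
    by (rule poly_growth_Lp; simp add: poly_growth_ornstein_uhlenbeck R)
  note const = energy_approx_const[OF R]
  have "(\<integral>\<omega>. G \<omega> \<partial>wiener) = - (\<integral>\<omega>. F \<omega> * ?H \<omega> \<partial>wiener)" if "is_gamma F R G" for F G
  proof -
    obtain S T where S: "energy_approx S F" and T: "energy_approx T R"
      and Gm: "G \<in> borel_measurable wiener"
      and lim: "(\<lambda>n. \<integral>\<^sup>+\<omega>. ennreal \<bar>cyl_gamma (S n) (T n) \<omega> - G \<omega>\<bar> \<partial>wiener) \<longlonglongrightarrow> 0"
      using \<open>is_gamma F R G\<close> unfolding is_gamma_def by blast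
    note sS = energy_approxD(2)[OF S] and sT = energy_approxD(2)[OF T]
    have U: "energy_approx (\<lambda>n y. T n y - R y) (\<lambda>_. 0)"
      using T R unfolding energy_approx_def by (auto intro!: smooth_cylindrical_diff zero_Lp_2)
    have "energy (S n) (T n) =
        - (\<integral>y. S n y * ?H y \<partial>wiener) + energy (S n) (\<lambda>y. T n y - R y)" for n
    proof -
      have "energy (S n) (\<lambda>y. T n y - R y) = energy (S n) (T n) - energy (S n) R"
        using energy_diff_left[OF sT R sS] by (simp add: energy_commute)
      moreover have "energy (S n) R = - (\<integral>y. S n y * ?H y \<partial>wiener)"
        unfolding energy_def by (rule integral_cyl_gamma[OF sS R k])
      ultimately show ?thesis by simp
    qed
    moreover have "(\<lambda>n. - (\<integral>y. S n y * ?H y \<partial>wiener) + energy (S n) (\<lambda>y. T n y - R y))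
        \<longlonglongrightarrow> - (\<integral>y. F y * ?H y \<partial>wiener) + 0"
      by (intro tendsto_add tendsto_minus energy_approx_zero[OF S U]
          integral_mult_tendsto[OF energy_approxD(1)[OF S] _ HL energy_approxD(3)[OF S]])
        (auto intro!: poly_growth_Lp sc sS)
    ultimately have "(\<lambda>n. energy (S n) (T n)) \<longlonglongrightarrow> - (\<integral>y. F y * ?H y \<partial>wiener)" by simp
    moreover have "(\<lambda>n. energy (S n) (T n)) \<longlonglongrightarrow> (\<integral>y. G y \<partial>wiener)"
      unfolding energy_def
      by (rule integrable_of_L1_limit(2)[OF integrable_cyl_gamma[OF sS sT] Gm lim])
    ultimately show ?thesis using LIMSEQ_unique by blast
  qed
  then show ?thesis
    unfolding is_generator_def Dom_gamma_def using const HL by blast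
qed

section \<open>Functions of one coordinate\<close>

lemma poly_growth_coordinate_function:
  assumes f: "poly_bounded f" and c: "continuous_on UNIV f"
  shows "poly_growth (\<lambda>y. f (y j))"
proof -
  obtain C m where C: "0 \<le> C" "\<And>x. \<bar>f x\<bar> \<le> C * (1 + \<bar>x\<bar>) ^ m" by (rule poly_boundedE[OF f]) blast
  show ?thesis
  proof (rule poly_growthI[of _ C "Suc j" m])
    show "continuous_on UNIV (\<lambda>y. f (y j))"
      by (rule continuous_on_compose2[OF c continuous_on_product_coordinates]) auto
    fix y :: "nat \<Rightarrow> real"
    have "\<bar>y j\<bar> \<le> (\<Sum>i<Suc j. \<bar>y i\<bar>)" by (rule member_le_sum) auto
    then have "C * (1 + \<bar>y j\<bar>) ^ m \<le> C * (1 + (\<Sum>i<Suc j. \<bar>y i\<bar>)) ^ m"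
      using C by (intro mult_left_mono power_mono) auto
    then show "\<bar>f (y j)\<bar> \<le> C * (1 + (\<Sum>i<Suc j. \<bar>y i\<bar>)) ^ m" using C(2)[of "y j"] by simp
  qed
qed

text \<open>Holds for every f: if k = j, both sides are the same total \<open>deriv\<close>, and
  otherwise the section is constant.\<close>

lemma partial_coordinate_function:
  "partial k (\<lambda>y. f (y j)) = (if k = j then (\<lambda>y. deriv f (y j)) else (\<lambda>_. 0))"
  by (auto simp: partial_def fun_eq_iff)

lemma coordinate_differentiable_coordinate_function:
  assumes "\<And>x. (f has_real_derivative f' x) (at x)"
  shows "coordinate_differentiable (\<lambda>y. f (y j))"
  unfolding coordinate_differentiable_def
proof (intro allI)
  fix k y
  show "(\<lambda>t. f ((y(k := t)) j)) differentiable at (y k)"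
    using assms[of "y j"] by (cases "k = j") (auto simp: real_differentiable_def)
qed

lemma depends_on_first_coordinate_function: "depends_on_first (Suc j) (\<lambda>y. f (y j))"
  by (simp add: depends_on_first_def)

text \<open>Along the list of indices, each partial derivative either differentiates the function of
  coordinate \<open>j\<close> or kills it. Being a tame function of that coordinate is therefore an
  invariant.\<close>

lemma smooth_cylindrical_coordinate_function:
  assumes "tame f" shows "smooth_cylindrical (\<lambda>y. f (y j))"
proof -
  have *: "\<exists>g. tame g \<and> foldr partial ks (\<lambda>y. f (y j)) = (\<lambda>y. g (y j))" for ks
  proof (induction ks)
    case Nil
    show ?case using assms by auto
  next
    case (Cons k ks)
    then obtain g where g: "tame g" "foldr partial ks (\<lambda>y. f (y j)) = (\<lambda>y. g (y j))" by blast
    show ?case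
    proof (cases "k = j")
      case True
      then show ?thesis using g tame_deriv(2) by (auto simp: partial_coordinate_function)
    next
      case False
      then have "foldr partial (k # ks) (\<lambda>y. f (y j)) = (\<lambda>y. (\<lambda>_. 0) (y j))"
        using g by (simp add: partial_coordinate_function)
      then show ?thesis using tame_const by blast
    qed
  qed
  have "poly_growth (foldr partial ks (\<lambda>y. f (y j))) \<and>
      coordinate_differentiable (foldr partial ks (\<lambda>y. f (y j)))" for ks
  proof -
    obtain g where g: "tame g" "foldr partial ks (\<lambda>y. f (y j)) = (\<lambda>y. g (y j))" using * by blast
    show ?thesis
      unfolding g(2) using g(1)
      by (intro conjI poly_growth_coordinate_function tame_poly_bounded tame_continuous
          coordinate_differentiable_coordinate_function[OF tame_deriv(1)])
  qed
  then show ?thesis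
    unfolding smooth_cylindrical_iff using depends_on_first_coordinate_function by blast
qed

lemma cyl_gamma_coordinate_function:
  "cyl_gamma (\<lambda>y. f (y j)) (\<lambda>y. g (y j)) = (\<lambda>y. deriv f (y j) * deriv g (y j))"
proof
  fix y :: "nat \<Rightarrow> real"
  have "cyl_gamma (\<lambda>y. f (y j)) (\<lambda>y. g (y j)) y =
      (\<Sum>k<Suc j. partial k (\<lambda>y. f (y j)) y * partial k (\<lambda>y. g (y j)) y)"
    by (rule cyl_gamma_eq_sum[OF depends_on_first_coordinate_function])
  also have "\<dots> = (\<Sum>k\<in>{j}. partial k (\<lambda>y. f (y j)) y * partial k (\<lambda>y. g (y j)) y)"
    by (rule sum.mono_neutral_right) (auto simp: partial_coordinate_function)
  finally show "cyl_gamma (\<lambda>y. f (y j)) (\<lambda>y. g (y j)) y = deriv f (y j) * deriv g (y j)"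
    by (simp add: partial_coordinate_function)
qed

text \<open>The one-dimensional Ornstein-Uhlenbeck operator, whose eigenfunctions are the Hermite
  polynomials.\<close>

definition hermite_operator :: "(real \<Rightarrow> real) \<Rightarrow> real \<Rightarrow> real" where
  "hermite_operator f x = deriv (deriv f) x - x * deriv f x"

lemma ornstein_uhlenbeck_coordinate_function:
  "ornstein_uhlenbeck (Suc j) (\<lambda>y. f (y j)) = (\<lambda>y. hermite_operator f (y j))"
proof
  fix y :: "nat \<Rightarrow> real"
  let ?t = "\<lambda>k. partial k (partial k (\<lambda>y. f (y j))) y - y k * partial k (\<lambda>y. f (y j)) y"
  have "partial k (partial k (\<lambda>y. f (y j))) y = 0" if "k \<noteq> j" for k
    using that partial_coordinate_function[of k "\<lambda>_. 0" j] by (simp add: partial_coordinate_function)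
  then have "(\<Sum>k<Suc j. ?t k) = (\<Sum>k\<in>{j}. ?t k)"
    by (intro sum.mono_neutral_right) (auto simp: partial_coordinate_function)
  then show "ornstein_uhlenbeck (Suc j) (\<lambda>y. f (y j)) y = hermite_operator f (y j)"
    by (simp add: ornstein_uhlenbeck_def hermite_operator_def partial_coordinate_function)
qed

lemma tame_hermite_operator:
  assumes "tame f" shows "tame (hermite_operator f)"
proof -
  have "tame (\<lambda>x. deriv (deriv f) x + (-1) * (x * deriv f x))"
    by (intro tame_add tame_mult tame_const tame_ident tame_deriv assms)
  then show ?thesis by (simp add: hermite_operator_def[abs_def])
qed

text \<open>Since \<open>hermite_operator\<close> preserves \<open>tame\<close>, its iterates supply
  versions of all iterates of L, each again smooth cylindrical.\<close>

lemma tame_coordinate_function_D_infty: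
  assumes "tame f" shows "(\<lambda>\<omega>. f (\<omega> j)) \<in> D_infty"
proof -
  let ?f = "\<lambda>k. (hermite_operator ^^ k) f"
  have t: "tame (?f k)" for k
    by (induction k) (simp_all add: assms tame_hermite_operator)
  let ?G = "\<lambda>k \<omega>. ?f k (\<omega> j)"
  have "is_generator (?G k) (?G (Suc k))" for k
    using is_generator_smooth_cylindrical[OF smooth_cylindrical_coordinate_function[OF t]
      depends_on_first_coordinate_function, of k j]
    by (simp add: ornstein_uhlenbeck_coordinate_function)
  moreover have "?G k \<in> Lp p" if "1 < p" for k p
    by (intro poly_growth_Lp smooth_cylindrical_poly_growth smooth_cylindrical_coordinate_function t that)
  ultimately show ?thesis unfolding D_infty_def by (intro CollectI exI[of _ ?G]) auto
qed

section \<open>The normal distribution function and its derivatives\<close>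

lemma set_integrable_std_normal_density:
  "A \<in> sets borel \<Longrightarrow> set_integrable lborel A std_normal_density"
  unfolding set_integrable_def by (rule integrable_mult_indicator) auto

lemma Phi_eq_integral: "Phi x = integral {..x} std_normal_density"
  using set_borel_integral_eq_integral(2)[OF set_integrable_std_normal_density, of "{..x}"]
  by (simp add: Phi_def std_normal_density_def)

lemma Phi_eq_measure: "Phi x = measure gauss {..x}"
proof -
  have "measure gauss {..x} = (\<integral>y. indicator {..x} y \<partial>gauss)" by simp
  also have "\<dots> = (\<integral>y. std_normal_density y * indicator {..x} y \<partial>lborel)"
    by (rule integral_gauss) auto
  also have "\<dots> = Phi x"
    unfolding Phi_def set_lebesgue_integral_def
    by (rule Bochner_Integration.integral_cong) (auto simp: std_normal_density_def)
  finally show ?thesis ..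
qed

lemma DERIV_Phi: "(Phi has_real_derivative std_normal_density x) (at x)"
proof -
  \<comment> \<open>The fundamental theorem of calculus is used on compact intervals, so the half
    line is cut at x - 1; x is interior to [x - 1, x + 1].\<close>
  let ?a = "x - 1"
  have c: "continuous_on A std_normal_density" for A
    by (intro continuous_at_imp_continuous_on) (blast intro: DERIV_isCont DERIV_std_normal_density)
  have i: "std_normal_density integrable_on A" if "A \<in> sets borel" for A
    by (rule set_borel_integral_eq_integral(1)[OF set_integrable_std_normal_density[OF that]])
  have eq: "Phi y = Phi ?a + integral {?a..y} std_normal_density" if "?a \<le> y" for y
  proof -
    have "(std_normal_density has_integral
        (integral {..?a} std_normal_density + integral {?a..y} std_normal_density)) ({..?a} \<union> {?a..y})"
      by (rule has_integral_Un) (use that in \<open>auto intro!: integrable_integral i\<close>)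
    moreover have "{..?a} \<union> {?a..y} = {..y}" using that by auto
    ultimately show ?thesis by (simp add: Phi_eq_integral integral_unique)
  qed
  have "((\<lambda>y. Phi ?a + integral {?a..y} std_normal_density) has_real_derivative std_normal_density x)
      (at x within {?a..x + 1})"
    using DERIV_add[OF DERIV_const integral_has_real_derivative[OF c, of x ?a "x + 1"]] by simp
  then have "((\<lambda>y. Phi ?a + integral {?a..y} std_normal_density) has_real_derivative std_normal_density x) (at x)"
    by (subst (asm) at_within_Icc_at) auto
  then show ?thesis
    by (rule has_field_derivative_transform_within_open[where S="{?a<..}"]) (simp_all add: eq[symmetric])
qed

lemma Phi_strict_mono:
  assumes "x < y" shows "Phi x < Phi y"
proof (rule DERIV_pos_imp_increasing[OF assms])
  fix z
  show "\<exists>d. (Phi has_real_derivative d) (at z) \<and> 0 < d"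
    by (intro exI[of _ "std_normal_density z"] conjI DERIV_Phi normal_density_pos) simp
qed

lemma Phi_bounds: "0 < Phi x" "Phi x < 1"
proof -
  have "0 \<le> Phi (x - 1)" "Phi (x + 1) \<le> 1" by (simp_all add: Phi_eq_measure)
  then show "0 < Phi x" "Phi x < 1"
    using Phi_strict_mono[of "x - 1" x] Phi_strict_mono[of x "x + 1"] by auto
qed

lemma Phi_continuous: "continuous_on A Phi"
  by (rule continuous_at_imp_continuous_on) (blast intro: DERIV_isCont DERIV_Phi)

text \<open>A Mills ratio bound: on the interval of length \<open>1 / (1 + |x|)\<close> on either side of \<open>x\<close>
  the density varies by a bounded factor only.\<close>

lemma std_normal_density_le_Phi:
  "std_normal_density x \<le> 2 * exp (3 / 2) * (1 + \<bar>x\<bar>) * (Phi x * (1 - Phi x))"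
proof -
  define d where "d = 1 / (1 + \<bar>x\<bar>)"
  have d: "0 < d" "d \<le> 1" "\<bar>x\<bar> * d \<le> 1" by (simp_all add: d_def field_simps)
  have low: "std_normal_density x \<le> exp (3 / 2) * std_normal_density z" if "\<bar>z\<bar> \<le> \<bar>x\<bar> + d" for z
  proof -
    have "\<bar>z\<bar>\<^sup>2 \<le> (\<bar>x\<bar> + d)\<^sup>2" using that by (intro power_mono) auto
    also have "\<dots> = x\<^sup>2 + 2 * (\<bar>x\<bar> * d) + d\<^sup>2" by (simp add: power2_sum)
    \<comment> \<open>Origin of the exponent: the square grows by at most 3, and the density halves
      this to 3/2.\<close>
    also have "\<dots> \<le> x\<^sup>2 + 2 * 1 + 1"
      using d power_le_one[of d 2] by (intro add_mono mult_left_mono) auto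
    finally have "- x\<^sup>2 / 2 \<le> 3 / 2 + - z\<^sup>2 / 2" by simp
    then have "exp (- x\<^sup>2 / 2) \<le> exp (3 / 2) * exp (- z\<^sup>2 / 2)"
      unfolding exp_add[symmetric] exp_le_cancel_iff .
    then show ?thesis
      unfolding std_normal_density_def
      using mult_left_mono[of "exp (- x\<^sup>2 / 2)" "exp (3 / 2) * exp (- z\<^sup>2 / 2)" "1 / sqrt (2 * pi)"]
      by (simp add: mult_ac)
  qed
  have step: "std_normal_density x * d \<le> exp (3 / 2) * (Phi b - Phi a)"
    if "b - a = d" "\<bar>a\<bar> \<le> \<bar>x\<bar> + d" "\<bar>b\<bar> \<le> \<bar>x\<bar> + d" for a b
  proof -
    have ab: "a < b" using d that by linarith
    obtain z where z: "a < z" "z < b" "Phi b - Phi a = (b - a) * std_normal_density z"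
      using MVT2[OF ab, of Phi std_normal_density] DERIV_Phi by blast
    then have "std_normal_density x \<le> exp (3 / 2) * std_normal_density z"
      using that by (intro low) linarith
    then have "std_normal_density x * d \<le> exp (3 / 2) * std_normal_density z * d"
      using d by (intro mult_right_mono) auto
    then show ?thesis using z that by (simp add: mult_ac)
  qed
  have "std_normal_density x * d \<le> exp (3 / 2) * (Phi x - Phi (x - d))"
    by (rule step) (use d in auto)
  also have "\<dots> \<le> exp (3 / 2) * Phi x" using Phi_bounds[of "x - d"] by simp
  finally have 1: "std_normal_density x * d \<le> exp (3 / 2) * Phi x" .
  have "std_normal_density x * d \<le> exp (3 / 2) * (Phi (x + d) - Phi x)"
    by (rule step) (use d in auto)
  also have "\<dots> \<le> exp (3 / 2) * (1 - Phi x)" using Phi_bounds[of "x + d"] by simp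
  finally have 2: "std_normal_density x * d \<le> exp (3 / 2) * (1 - Phi x)" .
  \<comment> \<open>One of \<open>Phi x\<close> and \<open>1 - Phi x\<close> is at least 1/2, so
    twice their product dominates the smaller one.\<close>
  have "std_normal_density x * d \<le> 2 * exp (3 / 2) * (Phi x * (1 - Phi x))"
  proof (cases "Phi x \<le> 1 / 2")
    case True
    have "Phi x * 1 \<le> Phi x * (2 * (1 - Phi x))"
      using True Phi_bounds[of x] by (intro mult_left_mono) auto
    then have "Phi x \<le> 2 * (Phi x * (1 - Phi x))" by (simp add: algebra_simps)
    then have "exp (3 / 2) * Phi x \<le> exp (3 / 2) * (2 * (Phi x * (1 - Phi x)))"
      by (intro mult_left_mono) simp_all
    with 1 show ?thesis by (simp only: mult_ac)
  next
    case False
    have "1 * (1 - Phi x) \<le> (2 * Phi x) * (1 - Phi x)"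
      using False Phi_bounds[of x] by (intro mult_right_mono) auto
    then have "1 - Phi x \<le> 2 * (Phi x * (1 - Phi x))" by (simp add: algebra_simps)
    then have "exp (3 / 2) * (1 - Phi x) \<le> exp (3 / 2) * (2 * (Phi x * (1 - Phi x)))"
      by (intro mult_left_mono) simp_all
    with 2 show ?thesis by (simp only: mult_ac)
  qed
  then show ?thesis by (simp add: d_def field_simps)
qed

text \<open>Together with its density phi, \<open>Phi\<close> generates an algebra closed under
  differentiation, because Phi' = phi and phi' = -x phi. Both generators are bounded by 1.\<close>

lemma tame_Phi: "tame Phi"
proof -
  let ?B = "\<lambda>f. f = Phi \<or> f = std_normal_density"
  have *: "std_normal_density x \<le> 1" for x
  proof -
    have "1 / sqrt (2 * pi) \<le> 1" using pi_ge_two by (simp add: real_le_rsqrt)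
    moreover have "exp (- x\<^sup>2 / 2) \<le> 1" by simp
    ultimately show ?thesis unfolding std_normal_density_def
      using mult_mono[of "1 / sqrt (2 * pi)" 1 "exp (- x\<^sup>2 / 2)" 1] by simp
  qed
  have "generated ?B Phi" by (rule generated.base) simp
  then show ?thesis
  proof (rule generated_tame[rotated])
    fix f assume "?B f"
    then show "poly_bounded f \<and> (\<exists>g. generated ?B g \<and> (\<forall>x. (f has_real_derivative g x) (at x)))"
    proof
      assume f: "f = Phi"
      have "poly_bounded Phi"
        by (rule poly_boundedI[of _ 1 0]) (simp add: abs_of_pos Phi_bounds less_imp_le)
      moreover have "generated ?B std_normal_density" by (rule generated.base) simp
      ultimately show ?thesis using DERIV_Phi f by blast
    next
      assume f: "f = std_normal_density"
      have "poly_bounded std_normal_density" by (rule poly_boundedI[of _ 1 0]) (use * in auto)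
      moreover have "generated ?B (\<lambda>x. (-1) * (x * std_normal_density x))"
        by (intro generated.mult generated.const generated.ident) (rule generated.base, simp)
      moreover have "(std_normal_density has_real_derivative (-1) * (x * std_normal_density x)) (at x)" for x
        using DERIV_std_normal_density[of x] by simp
      ultimately show ?thesis using f by blast
    qed
  qed
qed

section \<open>Composition with the normal distribution function\<close>

text \<open>The weight t (1 - t) is at most t near 0 and at most 1 - t near 1, where the two limsups
  apply. On the compact interval in between, continuity bounds f and the weight is at most
  1.\<close>

lemma weighted_bound_unit_interval:
  fixes f :: "real \<Rightarrow> real"
  assumes c: "continuous_on {0<..<1} f"
    and l: "Limsup (at_right 0) (\<lambda>t. ereal (t ^ k * \<bar>f t\<bar>)) < \<infinity>"
    and r: "Limsup (at_left 1) (\<lambda>t. ereal ((1 - t) ^ k * \<bar>f t\<bar>)) < \<infinity>"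
  obtains C where "\<And>t. 0 < t \<Longrightarrow> t < 1 \<Longrightarrow> (t * (1 - t)) ^ k * \<bar>f t\<bar> \<le> C"
proof -
  obtain C1 where C1: "\<forall>\<^sub>F t in at_right 0. t ^ k * \<bar>f t\<bar> < C1"
    using ereal_dense2[OF l] Limsup_lessD by fastforce
  obtain C2 where C2: "\<forall>\<^sub>F t in at_left 1. (1 - t) ^ k * \<bar>f t\<bar> < C2"
    using ereal_dense2[OF r] Limsup_lessD by fastforce
  obtain a where a: "0 < a" "\<And>t. 0 < t \<Longrightarrow> t < a \<Longrightarrow> t ^ k * \<bar>f t\<bar> < C1"
    using C1 unfolding eventually_at_right[OF zero_less_one] by blast
  obtain b where b: "b < 1" "\<And>t. b < t \<Longrightarrow> t < 1 \<Longrightarrow> (1 - t) ^ k * \<bar>f t\<bar> < C2"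
    using C2 unfolding eventually_at_left[OF zero_less_one] by blast
  define a' b' where "a' = min a (1 / 2)" and "b' = max b (1 / 2)"
  have ab: "0 < a'" "b' < 1" using a b by (auto simp: a'_def b'_def)
  have "continuous_on {a'..b'} f"
    by (rule continuous_on_subset[OF c]) (use ab in auto)
  then have "bounded (f ` {a'..b'})"
    by (intro compact_imp_bounded compact_continuous_image) auto
  then obtain C3 where C3: "\<And>t. t \<in> {a'..b'} \<Longrightarrow> \<bar>f t\<bar> \<le> C3"
    unfolding bounded_iff by (auto simp del: atLeastAtMost_iff)
  have "(t * (1 - t)) ^ k * \<bar>f t\<bar> \<le> max C1 (max C2 C3)" if t: "0 < t" "t < 1" for t
  proof -
    consider "t < a'" | "b' < t" | "t \<in> {a'..b'}" by fastforce
    then show ?thesis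
    proof cases
      case 1
      have "(t * (1 - t)) ^ k * \<bar>f t\<bar> \<le> t ^ k * \<bar>f t\<bar>"
        using t by (intro mult_right_mono power_mono) (auto intro: mult_left_le)
      then show ?thesis using a(2)[of t] t 1 by (simp add: a'_def)
    next
      case 2
      have "(t * (1 - t)) ^ k * \<bar>f t\<bar> \<le> (1 - t) ^ k * \<bar>f t\<bar>"
        using t by (intro mult_right_mono power_mono) (auto intro: mult_left_le_one_le)
      then show ?thesis using b(2)[of t] t 2 by (simp add: b'_def)
    next
      case 3
      have "t * (1 - t) \<le> 1" using t by (intro mult_le_one) auto
      then have "(t * (1 - t)) ^ k * \<bar>f t\<bar> \<le> 1 * \<bar>f t\<bar>"
        using t by (intro mult_right_mono power_le_one) auto
      then show ?thesis using C3[OF 3] by simp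
    qed
  qed
  then show ?thesis by (rule that)
qed

lemma tame_comp_Phi:
  assumes q: "smooth_on {0<..<1} q"
    and l: "\<And>k. 1 \<le> k \<Longrightarrow> Limsup (at_right 0) (\<lambda>t. ereal (t ^ k * \<bar>(deriv ^^ k) q t\<bar>)) < \<infinity>"
    and r: "\<And>k. 1 \<le> k \<Longrightarrow> Limsup (at_left 1) (\<lambda>t. ereal ((1 - t) ^ k * \<bar>(deriv ^^ k) q t\<bar>)) < \<infinity>"
  shows "tame (\<lambda>x. q (Phi x))"
proof -
  let ?Q = "\<lambda>k x. (deriv ^^ k) q (Phi x) * std_normal_density x ^ k"
  have dq: "((deriv ^^ k) q has_real_derivative (deriv ^^ Suc k) q t) (at t)" if "0 < t" "t < 1" for k t
    using q that unfolding smooth_on_def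
    by (auto simp: DERIV_deriv_iff_real_differentiable)
  have dQ: "(?Q k has_real_derivative ?Q (Suc k) x + (- real k) * (x * ?Q k x)) (at x)" for k x
  proof -
    have 1: "((\<lambda>x. (deriv ^^ k) q (Phi x)) has_real_derivative
        (deriv ^^ Suc k) q (Phi x) * std_normal_density x) (at x)"
      by (rule DERIV_chain2[OF dq DERIV_Phi]) (rule Phi_bounds)+
    have "((\<lambda>x. std_normal_density x ^ k) has_real_derivative
        real k * (std_normal_density x ^ (k - Suc 0) * (- x * std_normal_density x))) (at x)"
      using DERIV_power[OF DERIV_std_normal_density, of k x] by (simp add: mult_ac)
    moreover have "real k * (std_normal_density x ^ (k - Suc 0) * (- x * std_normal_density x)) =
        - real k * x * std_normal_density x ^ k"
      by (cases k) (simp_all add: algebra_simps)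
    ultimately have 2: "((\<lambda>x. std_normal_density x ^ k) has_real_derivative
        - real k * x * std_normal_density x ^ k) (at x)" by (rule DERIV_cong)
    show ?thesis using DERIV_mult[OF 1 2] by (simp add: mult_ac)
  qed
  have bQ: "poly_bounded (?Q k)" if k: "1 \<le> k" for k
  proof -
    have "continuous_on {0<..<1} ((deriv ^^ k) q)"
      by (rule continuous_at_imp_continuous_on) (use dq DERIV_isCont in fastforce)
    then obtain C where C: "\<And>t. 0 < t \<Longrightarrow> t < 1 \<Longrightarrow> (t * (1 - t)) ^ k * \<bar>(deriv ^^ k) q t\<bar> \<le> C"
      by (rule weighted_bound_unit_interval[OF _ l[OF k] r[OF k]]) blast
    let ?K = "2 * exp (3 / 2) :: real"
    show ?thesis
    proof (rule poly_boundedI)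
      fix x
      let ?t = "Phi x"
      have "\<bar>?Q k x\<bar> = \<bar>(deriv ^^ k) q ?t\<bar> * std_normal_density x ^ k"
        by (simp add: abs_mult)
      \<comment> \<open>Each of the k density factors supplies one factor t (1 - t), which
        compensates the blow-up of the k-th derivative at the cost of one power of 1 + |x|.\<close>
      also have "\<dots> \<le> \<bar>(deriv ^^ k) q ?t\<bar> * (?K * (1 + \<bar>x\<bar>) * (?t * (1 - ?t))) ^ k"
        by (intro mult_left_mono power_mono std_normal_density_le_Phi) auto
      also have "\<dots> = (?K * (1 + \<bar>x\<bar>)) ^ k * ((?t * (1 - ?t)) ^ k * \<bar>(deriv ^^ k) q ?t\<bar>)"
        by (simp add: power_mult_distrib mult_ac)
      also have "\<dots> \<le> (?K * (1 + \<bar>x\<bar>)) ^ k * C"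
        by (intro mult_left_mono C Phi_bounds) auto
      finally show "\<bar>?Q k x\<bar> \<le> (?K ^ k * C) * (1 + \<bar>x\<bar>) ^ k"
        by (simp add: power_mult_distrib mult_ac)
    qed
  qed
  let ?B = "\<lambda>f. \<exists>k. f = ?Q k"
  have "generated ?B (?Q 0)" by (rule generated.base) blast
  then have "tame (?Q 0)"
  proof (rule generated_tame[rotated])
    fix f assume "?B f"
    then obtain k where f: "f = ?Q k" by blast
    have "poly_bounded (?Q k)"
    proof (cases "k = 0")
      \<comment> \<open>The limsup bounds start at k = 1. In \<open>dQ 0\<close> the second term
        vanishes, so \<open>?Q 0\<close> is an antiderivative of \<open>?Q 1\<close> and inherits
        polynomial growth.\<close>
      case True
      have "poly_bounded (?Q 0)"
        by (rule poly_bounded_antiderivative[OF bQ[of 1]]) (use dQ[of 0] in simp_all)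
      then show ?thesis using True by simp
    next
      case False
      then show ?thesis by (intro bQ) simp
    qed
    moreover have "generated ?B (\<lambda>x. ?Q (Suc k) x + (- real k) * (x * ?Q k x))"
      by (rule generated.add[OF generated.base generated.mult[OF generated.const generated.mult[OF
              generated.ident generated.base]]]) blast+
    ultimately show "poly_bounded f \<and> (\<exists>g. generated ?B g \<and> (\<forall>x. (f has_real_derivative g x) (at x)))"
      using dQ[of k] f by blast
  qed
  then show ?thesis by simp
qed

section \<open>The carre du champ of continuously differentiable functions of one coordinate\<close>

lemma is_gamma_tame:
  assumes "tame f"
  shows "is_gamma (\<lambda>\<omega>. f (\<omega> j)) (\<lambda>\<omega>. f (\<omega> j)) (\<lambda>\<omega>. (deriv f (\<omega> j))\<^sup>2)"
proof -
  have s: "smooth_cylindrical (\<lambda>\<omega>. f (\<omega> j))"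
    by (rule smooth_cylindrical_coordinate_function[OF assms])
  have "cyl_gamma (\<lambda>\<omega>. f (\<omega> j)) (\<lambda>\<omega>. f (\<omega> j)) = (\<lambda>\<omega>. (deriv f (\<omega> j))\<^sup>2)"
    by (simp add: cyl_gamma_coordinate_function power2_eq_square)
  then show ?thesis
    unfolding is_gamma_def
    using energy_approx_const[OF s] poly_growth_measurable[OF poly_growth_cyl_gamma[OF s s]]
    by (intro conjI exI[of _ "\<lambda>_. \<lambda>\<omega>. f (\<omega> j)"]) simp_all
qed

lemma antiderivative_exists:
  fixes f :: "real \<Rightarrow> real"
  assumes "continuous_on UNIV f"
  obtains F where "\<And>x. (F has_real_derivative f x) (at x)" "F 0 = c"
proof -
  obtain F where F: "\<And>x. (F has_real_derivative f x) (at x)"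
    using einterval_antiderivative[of "-\<infinity>" \<infinity> f] assms
    by (auto simp: continuous_on_eq_continuous_at has_real_derivative_iff_has_vector_derivative)
  have "((\<lambda>x. F x - F 0 + c) has_real_derivative f x) (at x)" for x
    by (auto intro!: derivative_eq_intros F)
  then show ?thesis by (rule that) simp
qed

lemma tame_polynomial_Phi:
  assumes "real_polynomial_function p" shows "tame (\<lambda>x. p (Phi x))"
  using assms
proof induction
  case (linear f)
  then obtain c where c: "f = (\<lambda>x. x * c)" unfolding real_bounded_linear by blast
  show ?case unfolding c by (intro tame_mult tame_const tame_Phi)
next
  case (const c)
  show ?case by (rule tame_const)
next
  case (add f g)
  then show ?case by (intro tame_add)
next
  case (mult f g)
  then show ?case by (intro tame_mult)
qed

text \<open>Polynomials in \<open>Phi\<close> approximate the derivative uniformly on the whole line; their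
  antiderivatives are smooth and of polynomial growth.\<close>

lemma is_gamma_C1:
  assumes h: "\<And>x. (h has_real_derivative w (Phi x)) (at x)" and w: "continuous_on {0..1} w"
  shows "is_gamma (\<lambda>\<omega>. h (\<omega> j)) (\<lambda>\<omega>. h (\<omega> j)) (\<lambda>\<omega>. (w (Phi (\<omega> j)))\<^sup>2)"
proof -
  define c where "c n = 1 / (real n + 1)" for n
  have c: "0 < c n" "c n \<le> 1" for n by (simp_all add: c_def)
  have c0: "c \<longlonglongrightarrow> 0"
    unfolding c_def using LIMSEQ_inverse_real_of_nat by (simp add: inverse_eq_divide add.commute)
  have P: "Phi x \<in> {0..1}" for x using Phi_bounds[of x] by simp
  \<comment> \<open>Reading h' as a function w of \<open>Phi\<close> moves the approximation problem
    from the whole line to the compact interval [0, 1], where Weierstrass applies.\<close>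
  have "\<exists>p. real_polynomial_function p \<and> (\<forall>t\<in>{0..1}. \<bar>w t - p t\<bar> < c n)" for n
    by (rule Stone_Weierstrass_real_polynomial_function[OF compact_Icc w c(1)[of n]]) blast
  then obtain p where p: "\<And>n. real_polynomial_function (p n)"
    and wp: "\<And>n t. t \<in> {0..1} \<Longrightarrow> \<bar>w t - p n t\<bar> < c n" by metis
  have tp: "tame (\<lambda>x. p n (Phi x))" for n by (rule tame_polynomial_Phi[OF p])
  have "\<exists>s. (\<forall>x. (s has_real_derivative p n (Phi x)) (at x)) \<and> s 0 = h 0" for n
    using antiderivative_exists[OF tame_continuous[OF tp]] by metis
  then obtain s where s: "\<And>n x. (s n has_real_derivative p n (Phi x)) (at x)" and s0: "\<And>n. s n 0 = h 0"
    by metis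
  have ds: "deriv (s n) x = p n (Phi x)" for n x by (rule DERIV_imp_deriv[OF s])
  have ts: "tame (s n)" for n by (rule tame_antiderivative[OF tp s])
  have gc: "continuous_on UNIV (\<lambda>x. w (Phi x))"
    by (rule continuous_on_compose2[OF w Phi_continuous]) (use P in auto)
  have "bounded (w ` {0..1})" by (intro compact_imp_bounded compact_continuous_image w) auto
  then obtain B where B: "\<And>t. t \<in> {0..1} \<Longrightarrow> \<bar>w t\<bar> \<le> B" unfolding bounded_iff by (auto simp del: atLeastAtMost_iff)
  have pbg: "poly_bounded (\<lambda>x. w (Phi x))" by (rule poly_boundedI[of _ B 0]) (use B P in simp)
  have pbh: "poly_bounded h" by (rule poly_bounded_antiderivative[OF pbg h])
  have hc: "continuous_on UNIV h" by (intro continuous_at_imp_continuous_on) (use h DERIV_isCont in blast)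
  have sm: "smooth_cylindrical (\<lambda>\<omega>. s n (\<omega> j))" for n
    by (rule smooth_cylindrical_coordinate_function[OF ts])
  have hL: "(\<lambda>\<omega>. h (\<omega> j)) \<in> Lp 2"
    by (rule poly_growth_Lp[OF poly_growth_coordinate_function[OF pbh hc]]) simp
  \<comment> \<open>Equal values at 0 and derivatives within \<open>c n\<close> of each other leave
    an error of at most \<open>c n\<close> times |x|; this is not uniformly small, but it is small
    in Gaussian L^2.\<close>
  have dist: "\<bar>s n x - h x\<bar> \<le> c n * \<bar>x\<bar>" for n x
  proof -
    have "norm ((s n x - h x) - (s n 0 - h 0)) \<le> c n * norm (x - 0)"
    proof (rule field_differentiable_bound[of UNIV "\<lambda>x. s n x - h x" "\<lambda>x. p n (Phi x) - w (Phi x)"])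
      show "((\<lambda>x. s n x - h x) has_field_derivative p n (Phi z) - w (Phi z)) (at z within UNIV)" for z
        using DERIV_diff[OF s h] by simp
      show "norm (p n (Phi z) - w (Phi z)) \<le> c n" for z
        using wp[OF P, of z n] by (simp add: abs_minus_commute)
    qed auto
    then show ?thesis using s0 by simp
  qed
  have L2: "(\<lambda>n. \<integral>\<^sup>+\<omega>. ennreal ((s n (\<omega> j) - h (\<omega> j))\<^sup>2) \<partial>wiener) \<longlonglongrightarrow> 0"
  proof (rule tendsto_sandwich[where f="\<lambda>_. 0"])
    let ?K = "\<integral>\<omega>. \<bar>\<omega> j\<bar> ^ 2 \<partial>wiener"
    have i: "integrable wiener (\<lambda>\<omega>. \<bar>\<omega> j\<bar> ^ 2)"
      by (rule integrable_coordinate[THEN iffD2, OF _ integrable_gauss_abs_power]) simp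
    have "(\<integral>\<^sup>+\<omega>. ennreal ((s n (\<omega> j) - h (\<omega> j))\<^sup>2) \<partial>wiener) \<le> ennreal ((c n)\<^sup>2 * ?K)" for n
    proof -
      have "(s n x - h x)\<^sup>2 \<le> (c n)\<^sup>2 * \<bar>x\<bar> ^ 2" for x
        using power_mono[OF dist[of n x] abs_ge_zero, of 2] by (simp add: power_mult_distrib)
      then have "(\<integral>\<^sup>+\<omega>. ennreal ((s n (\<omega> j) - h (\<omega> j))\<^sup>2) \<partial>wiener)
          \<le> (\<integral>\<^sup>+\<omega>. ennreal ((c n)\<^sup>2 * \<bar>\<omega> j\<bar> ^ 2) \<partial>wiener)"
        by (intro nn_integral_mono ennreal_leI)
      also have "\<dots> = ennreal (\<integral>\<omega>. (c n)\<^sup>2 * \<bar>\<omega> j\<bar> ^ 2 \<partial>wiener)"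
        by (rule nn_integral_eq_integral) (intro integrable_mult_right i, simp)
      finally show ?thesis by simp
    qed
    then show "\<forall>\<^sub>F n in sequentially.
        (\<integral>\<^sup>+\<omega>. ennreal ((s n (\<omega> j) - h (\<omega> j))\<^sup>2) \<partial>wiener) \<le> ennreal ((c n)\<^sup>2 * ?K)" by simp
    have "(\<lambda>n. (c n)\<^sup>2 * ?K) \<longlonglongrightarrow> 0\<^sup>2 * ?K" by (intro tendsto_intros c0)
    then have "(\<lambda>n. ennreal ((c n)\<^sup>2 * ?K)) \<longlonglongrightarrow> ennreal (0\<^sup>2 * ?K)" by (rule tendsto_ennrealI)
    then show "(\<lambda>n. ennreal ((c n)\<^sup>2 * ?K)) \<longlonglongrightarrow> 0" by simp
  qed auto
  have cauchy: "\<exists>M. \<forall>m\<ge>M. \<forall>n\<ge>M. (\<integral>\<^sup>+\<omega>. ennreal (cyl_gamma (\<lambda>\<omega>. s m (\<omega> j) - s n (\<omega> j))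
      (\<lambda>\<omega>. s m (\<omega> j) - s n (\<omega> j)) \<omega>) \<partial>wiener) < ennreal e" if e: "0 < e" for e
  proof -
    have "(\<lambda>n. (2 * c n)\<^sup>2) \<longlonglongrightarrow> (2 * 0)\<^sup>2" by (intro tendsto_intros c0)
    then have "\<forall>\<^sub>F n in sequentially. (2 * c n)\<^sup>2 < e" using e by (intro order_tendstoD) auto
    then obtain M where M: "(2 * c M)\<^sup>2 < e" using eventually_happens' sequentially_bot by blast
    have mono: "c n \<le> c M" if "M \<le> n" for n using that by (simp add: c_def frac_le)
    show ?thesis
    proof (intro exI allI impI)
      fix m n assume mn: "M \<le> m" "M \<le> n"
      have "deriv (\<lambda>x. s m x - s n x) x = p m (Phi x) - p n (Phi x)" for x
        by (rule DERIV_imp_deriv[OF DERIV_diff[OF s s]])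
      then have g: "cyl_gamma (\<lambda>\<omega>. s m (\<omega> j) - s n (\<omega> j)) (\<lambda>\<omega>. s m (\<omega> j) - s n (\<omega> j)) \<omega>
          = (p m (Phi (\<omega> j)) - p n (Phi (\<omega> j)))\<^sup>2" for \<omega>
        using cyl_gamma_coordinate_function[of "\<lambda>x. s m x - s n x" j "\<lambda>x. s m x - s n x"]
        by (simp add: power2_eq_square)
      have b: "(p m (Phi x) - p n (Phi x))\<^sup>2 \<le> (2 * c M)\<^sup>2" for x
      proof -
        have "\<bar>p m (Phi x) - p n (Phi x)\<bar> \<le> 2 * c M"
          using wp[OF P, of x m] wp[OF P, of x n] mono[OF mn(1)] mono[OF mn(2)] by linarith
        then show ?thesis using power_mono[OF _ abs_ge_zero, of _ _ 2] by fastforce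
      qed
      have "(\<integral>\<^sup>+\<omega>. ennreal (cyl_gamma (\<lambda>\<omega>. s m (\<omega> j) - s n (\<omega> j))
          (\<lambda>\<omega>. s m (\<omega> j) - s n (\<omega> j)) \<omega>) \<partial>wiener) \<le> (\<integral>\<^sup>+\<omega>. ennreal ((2 * c M)\<^sup>2) \<partial>wiener)"
        unfolding g by (intro nn_integral_mono ennreal_leI b)
      also have "\<dots> = ennreal ((2 * c M)\<^sup>2)" using wiener.emeasure_space_1 by simp
      also have "\<dots> < ennreal e" using M e by (simp add: ennreal_lessI)
      finally show "(\<integral>\<^sup>+\<omega>. ennreal (cyl_gamma (\<lambda>\<omega>. s m (\<omega> j) - s n (\<omega> j))
          (\<lambda>\<omega>. s m (\<omega> j) - s n (\<omega> j)) \<omega>) \<partial>wiener) < ennreal e" .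
    qed
  qed
  have approx: "energy_approx (\<lambda>n \<omega>. s n (\<omega> j)) (\<lambda>\<omega>. h (\<omega> j))"
    unfolding energy_approx_def using hL sm L2 cauchy by blast
  have "(\<lambda>n. \<integral>\<^sup>+\<omega>. ennreal \<bar>cyl_gamma (\<lambda>\<omega>. s n (\<omega> j)) (\<lambda>\<omega>. s n (\<omega> j)) \<omega> - (w (Phi (\<omega> j)))\<^sup>2\<bar> \<partial>wiener) \<longlonglongrightarrow> 0"
  proof (rule tendsto_sandwich[where f="\<lambda>_. 0"])
    let ?b = "\<lambda>n. c n * (2 * B + 1)"
    have B0: "0 \<le> B" using order_trans[OF abs_ge_zero B[of 0]] by simp
    have b: "\<bar>(p n (Phi x))\<^sup>2 - (w (Phi x))\<^sup>2\<bar> \<le> ?b n" for n x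
    proof -
      have 1: "\<bar>p n (Phi x) - w (Phi x)\<bar> \<le> c n" using wp[OF P, of x n] by linarith
      have "\<bar>p n (Phi x) + w (Phi x)\<bar> \<le> 2 * B + 1"
        using 1 B[OF P, of x] c(2)[of n] by linarith
      then have "\<bar>p n (Phi x) - w (Phi x)\<bar> * \<bar>p n (Phi x) + w (Phi x)\<bar> \<le> c n * (2 * B + 1)"
        using 1 c(1)[of n] by (intro mult_mono) auto
      then show ?thesis by (simp add: abs_mult[symmetric] power2_eq_square algebra_simps)
    qed
    have "(\<integral>\<^sup>+\<omega>. ennreal \<bar>cyl_gamma (\<lambda>\<omega>. s n (\<omega> j)) (\<lambda>\<omega>. s n (\<omega> j)) \<omega> - (w (Phi (\<omega> j)))\<^sup>2\<bar> \<partial>wiener)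
        \<le> ennreal (?b n)" for n
    proof -
      have "(\<integral>\<^sup>+\<omega>. ennreal \<bar>cyl_gamma (\<lambda>\<omega>. s n (\<omega> j)) (\<lambda>\<omega>. s n (\<omega> j)) \<omega> - (w (Phi (\<omega> j)))\<^sup>2\<bar> \<partial>wiener)
          \<le> (\<integral>\<^sup>+\<omega>. ennreal (?b n) \<partial>wiener)"
        unfolding cyl_gamma_coordinate_function ds power2_eq_square[symmetric]
        by (intro nn_integral_mono ennreal_leI b)
      then show ?thesis using wiener.emeasure_space_1 by simp
    qed
    then show "\<forall>\<^sub>F n in sequentially. (\<integral>\<^sup>+\<omega>. ennreal \<bar>cyl_gamma (\<lambda>\<omega>. s n (\<omega> j)) (\<lambda>\<omega>. s n (\<omega> j)) \<omega> - (w (Phi (\<omega> j)))\<^sup>2\<bar> \<partial>wiener)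
        \<le> ennreal (?b n)" by simp
    have "?b \<longlonglongrightarrow> 0 * (2 * B + 1)" by (intro tendsto_intros c0)
    then have "(\<lambda>n. ennreal (?b n)) \<longlonglongrightarrow> ennreal (0 * (2 * B + 1))" by (rule tendsto_ennrealI)
    then show "(\<lambda>n. ennreal (?b n)) \<longlonglongrightarrow> 0" by simp
  qed auto
  moreover have "(\<lambda>\<omega>. (w (Phi (\<omega> j)))\<^sup>2) \<in> borel_measurable wiener"
    by (intro poly_growth_measurable poly_growth_power poly_growth_coordinate_function[OF pbg gc])
  ultimately show ?thesis unfolding is_gamma_def using approx by blast
qed

lemma is_gamma_loc_C1:
  assumes f: "\<And>x. (f has_real_derivative g x) (at x)" and g: "continuous_on UNIV g"
  shows "is_gamma_loc (\<lambda>\<omega>. f (\<omega> j)) (\<lambda>\<omega>. (g (\<omega> j))\<^sup>2)"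
proof -
  have inj: "inj Phi" by (rule strict_mono_imp_inj_on) (simp add: strict_mono_def Phi_strict_mono)
  define \<psi> where "\<psi> = inv Phi"
  have \<psi>: "\<psi> (Phi x) = x" for x by (simp add: \<psi>_def inj)
  define clip where "clip n x = max (- real n) (min (real n) x)" for n x
  \<comment> \<open>The value of g at the clipped point, in the coordinate t = Phi x. Clipping t
    itself keeps the argument of \<psi> in the range of \<open>Phi\<close>, so that
    \<open>w n\<close> makes sense and is continuous up to 0 and 1.\<close>
  define w where "w n t = g (\<psi> (max (Phi (- real n)) (min (Phi (real n)) t)))" for n t
  have mono: "x \<le> y \<Longrightarrow> Phi x \<le> Phi y" for x y using Phi_strict_mono[of x y] by (cases "x = y") auto
  have w_Phi: "w n (Phi x) = g (clip n x)" for n x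
  proof -
    have "max (Phi (- real n)) (min (Phi (real n)) (Phi x)) = Phi (clip n x)"
      by (simp add: clip_def max_of_mono min_of_mono monoI mono)
    then show ?thesis by (simp add: w_def \<psi>)
  qed
  have w_cont: "continuous_on {0..1} (w n)" for n
  proof -
    let ?A = "{- real n..real n}"
    have "continuous_on (Phi ` ?A) \<psi>"
      by (rule continuous_on_inv[OF Phi_continuous]) (auto simp: \<psi>)
    moreover have "max (Phi (- real n)) (min (Phi (real n)) t) \<in> Phi ` ?A" for t
    proof -
      let ?t = "max (Phi (- real n)) (min (Phi (real n)) t)"
      have "Phi (- real n) \<le> ?t" "?t \<le> Phi (real n)" using mono[of "- real n" "real n"] by auto
      then obtain x where "- real n \<le> x" "x \<le> real n" "Phi x = ?t"
        using IVT'[of Phi "- real n" ?t "real n", OF _ _ _ Phi_continuous] by auto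
      then show ?thesis by (metis atLeastAtMost_iff image_eqI)
    qed
    ultimately have "continuous_on {0..1} (\<lambda>t. \<psi> (max (Phi (- real n)) (min (Phi (real n)) t)))"
      by (elim continuous_on_compose2) (auto intro!: continuous_intros)
    then show ?thesis
      unfolding w_def[abs_def] by (rule continuous_on_compose2[OF g]) auto
  qed
  have "\<exists>h. (\<forall>x. (h has_real_derivative w n (Phi x)) (at x)) \<and> h 0 = f 0" for n
  proof -
    have "continuous_on UNIV (\<lambda>x. w n (Phi x))"
      by (rule continuous_on_compose2[OF w_cont Phi_continuous])
        (auto intro: less_imp_le[OF Phi_bounds(1)] less_imp_le[OF Phi_bounds(2)])
    then show ?thesis using antiderivative_exists by metis
  qed
  then obtain h where h: "\<And>n x. (h n has_real_derivative w n (Phi x)) (at x)" and h0: "\<And>n. h n 0 = f 0"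
    by metis
  have agree: "f x = h n x" if x: "\<bar>x\<bar> \<le> real n" for n x
  proof -
    have "norm ((f x - h n x) - (f 0 - h n 0)) \<le> 0 * norm (x - 0)"
    proof (rule field_differentiable_bound[of "{- real n..real n}" "\<lambda>x. f x - h n x" "\<lambda>x. g x - w n (Phi x)"])
      show "((\<lambda>x. f x - h n x) has_field_derivative g z - w n (Phi z)) (at z within {- real n..real n})" for z
        by (rule DERIV_subset[OF DERIV_diff[OF f h]]) simp
      show "norm (g z - w n (Phi z)) \<le> 0" if "z \<in> {- real n..real n}" for z
        using that by (simp add: w_Phi clip_def)
    qed (use x in auto)
    then show ?thesis using h0 by simp
  qed
  have fc: "continuous_on UNIV f" by (intro continuous_at_imp_continuous_on) (use f DERIV_isCont in blast)
  have [measurable]: "f \<in> borel_measurable borel" "g \<in> borel_measurable borel"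
    by (intro borel_measurable_continuous_onI fc g)+
  show ?thesis
    unfolding is_gamma_loc_def
  proof (intro conjI exI allI)
    show "(\<lambda>\<omega>. f (\<omega> j)) \<in> borel_measurable wiener" "(\<lambda>\<omega>. (g (\<omega> j))\<^sup>2) \<in> borel_measurable wiener"
      by measurable
    fix n
    have "{\<omega> \<in> space wiener. \<bar>\<omega> j\<bar> \<le> real n} \<in> sets wiener" by measurable
    then show "{\<omega>. \<bar>\<omega> j\<bar> \<le> real n} \<in> sets wiener" by simp
    show "AE \<omega> in wiener. \<exists>n. \<omega> \<in> {\<omega>. \<bar>\<omega> j\<bar> \<le> real n}"
      by (simp add: real_arch_simple)
    show "is_gamma (\<lambda>\<omega>. h n (\<omega> j)) (\<lambda>\<omega>. h n (\<omega> j)) (\<lambda>\<omega>. (w n (Phi (\<omega> j)))\<^sup>2)"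
      by (rule is_gamma_C1[OF h w_cont])
    show "AE \<omega> in wiener. \<omega> \<in> {\<omega>. \<bar>\<omega> j\<bar> \<le> real n} \<longrightarrow>
        f (\<omega> j) = h n (\<omega> j) \<and> (g (\<omega> j))\<^sup>2 = (w n (Phi (\<omega> j)))\<^sup>2"
      using agree by (auto simp: w_Phi clip_def)
  qed
qed

section \<open>Small values of the carre du champ\<close>

abbreviation unit_uniform :: "real measure" where
  "unit_uniform \<equiv> restrict_space lborel {0<..<1}"

lemma distr_quantile:
  assumes "real_distribution \<mu>"
  shows "distr unit_uniform borel (quantile \<mu>) = \<mu>"
    and "quantile \<mu> \<in> borel_measurable (restrict_space borel {0<..<1})"
proof -
  interpret cdf_distribution \<mu> unfolding cdf_distribution_def by (rule assms)
  show "distr unit_uniform borel (quantile \<mu>) = \<mu>"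
    using distr_I_eq_M by (simp add: quantile_def[abs_def])
  show "quantile \<mu> \<in> borel_measurable (restrict_space borel {0<..<1})"
    using measurable_CI by (simp add: quantile_def[abs_def])
qed

lemma quantile_mono_on:
  assumes "real_distribution \<mu>" shows "mono_on {0<..<1} (quantile \<mu>)"
proof -
  interpret cdf_distribution \<mu> unfolding cdf_distribution_def by (rule assms)
  show ?thesis using mono_I by (simp add: quantile_def[abs_def])
qed

text \<open>By definition of the quantile, t \<le> Phi x exactly when x is at least the quantile. A
  strict inequality at the quantile would persist slightly to its left by continuity, against this
  equivalence.\<close>

lemma Phi_quantile_gauss:
  assumes t: "0 < t" "t < 1" shows "Phi (quantile gauss t) = t"
proof -
  interpret cdf_distribution gauss
    unfolding cdf_distribution_def by (rule gauss.real_distribution_axioms)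
  have P: "cdf gauss x = Phi x" for x by (simp add: cdf_def Phi_eq_measure)
  have iff: "t \<le> Phi x \<longleftrightarrow> quantile gauss t \<le> x" for x
    using pseudoinverse[OF t, of x] unfolding P quantile_def .
  have "\<not> t < Phi (quantile gauss t)"
  proof
    assume "t < Phi (quantile gauss t)"
    then have "\<forall>\<^sub>F x in at_left (quantile gauss t). t < Phi x"
      using order_tendstoD(1)[OF isContD[OF DERIV_isCont[OF DERIV_Phi]]]
      by (auto simp: eventually_at_split)
    moreover have "\<forall>\<^sub>F x in at_left (quantile gauss t). x < quantile gauss t"
      by (simp add: eventually_at_filter)
    ultimately have "\<forall>\<^sub>F x in at_left (quantile gauss t). x < quantile gauss t \<and> t < Phi x"
      by (simp add: eventually_conj_iff)
    then obtain x where "x < quantile gauss t" "t < Phi x"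
      using eventually_happens' trivial_limit_at_left_real by blast
    then show False using iff[of x] by simp
  qed
  then show ?thesis using iff[of "quantile gauss t"] by simp
qed

lemma measurable_Phi: "Phi \<in> measurable gauss unit_uniform"
proof (rule measurable_restrict_space2)
  show "Phi \<in> measurable gauss lborel"
    using borel_measurable_continuous_onI[OF Phi_continuous] by simp
qed (simp add: Phi_bounds)

text \<open>Probability integral transform: the Gaussian law is the image of the uniform law under
  its own quantile function, and \<open>Phi\<close> undoes that function.\<close>

lemma distr_Phi: "distr gauss unit_uniform Phi = unit_uniform"
proof -
  have m: "quantile gauss \<in> measurable unit_uniform borel"
    using distr_quantile(2)[OF gauss.real_distribution_axioms]
    by (simp cong: measurable_cong_sets restrict_space_sets_cong)
  have "distr gauss unit_uniform Phi = distr (distr unit_uniform borel (quantile gauss)) unit_uniform Phi"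
    by (simp add: distr_quantile(1)[OF gauss.real_distribution_axioms])
  also have "\<dots> = distr unit_uniform unit_uniform (Phi \<circ> quantile gauss)"
    by (rule distr_distr) (use measurable_Phi m in simp_all)
  also have "\<dots> = distr unit_uniform unit_uniform (\<lambda>t. t)"
    by (rule distr_cong) (auto simp: space_restrict_space Phi_quantile_gauss)
  finally show ?thesis by simp
qed

lemma distr_quantile_Phi_coordinate:
  assumes "real_distribution \<mu>"
  shows "distr wiener borel (\<lambda>\<omega>. quantile \<mu> (Phi (\<omega> j))) = \<mu>"
proof -
  have m: "quantile \<mu> \<in> measurable unit_uniform borel"
    using distr_quantile(2)[OF assms] by (simp cong: measurable_cong_sets restrict_space_sets_cong)
  have qP: "(\<lambda>x. quantile \<mu> (Phi x)) \<in> borel_measurable borel"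
    using measurable_compose[OF measurable_Phi m] by simp
  have "distr wiener borel (\<lambda>\<omega>. quantile \<mu> (Phi (\<omega> j))) = distr (distr wiener borel (\<lambda>\<omega>. \<omega> j)) borel (\<lambda>x. quantile \<mu> (Phi x))"
    by (subst distr_distr) (use qP in \<open>auto simp: comp_def\<close>)
  also have "\<dots> = distr (distr gauss unit_uniform Phi) borel (quantile \<mu>)"
    unfolding distr_coordinate by (subst distr_distr[OF m measurable_Phi]) (simp add: comp_def)
  also have "\<dots> = \<mu>" unfolding distr_Phi by (rule distr_quantile(1)[OF assms])
  finally show "distr wiener borel (\<lambda>\<omega>. quantile \<mu> (Phi (\<omega> j))) = \<mu>" .
qed

section \<open>Power bounds for small values of the quantile derivative and of the Gaussian
  density\<close>

lemma density_small_set_bound: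
  fixes f :: "real \<Rightarrow> real"
  assumes [measurable]: "f \<in> borel_measurable borel" and f0: "\<And>x. 0 \<le> f x" and e: "0 < e"
    and int: "integrable lborel (\<lambda>x. f x powr (1 + e))"
    and T: "T \<in> sets borel" "emeasure lborel T \<le> ennreal (2 * s)" and s: "0 < s"
  shows "emeasure (density lborel (\<lambda>x. ennreal (f x))) T \<le>
    ennreal ((2 + (\<integral>x. f x powr (1 + e) \<partial>lborel)) * s powr (e / (1 + e)))"
proof -
  \<comment> \<open>Truncation level. Where f exceeds m it is at most f^(1+e) m^(-e), so the mass of
    T is at most 2 m s plus m^(-e) times the integral of f^(1+e). This m balances the two: m s and
    m^(-e) both equal s^(e/(1+e)).\<close>
  define m where "m = s powr (- (1 / (1 + e)))"
  have m: "0 < m" using s by (simp add: m_def)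
  have split: "f x \<le> m + f x powr (1 + e) * m powr (- e)" for x
  proof (cases "f x \<le> m")
    case True
    then show ?thesis by (simp add: add_increasing2)
  next
    case False
    have "1 = f x powr e * f x powr (- e)" using False m by (simp add: powr_add[symmetric])
    also have "\<dots> \<le> f x powr e * m powr (- e)"
      using False m e by (intro mult_left_mono powr_mono2') auto
    finally have "f x * 1 \<le> f x * (f x powr e * m powr (- e))"
      using f0 by (intro mult_left_mono) auto
    also have "\<dots> = f x powr (1 + e) * m powr (- e)"
      using False m by (simp add: powr_add)
    finally show ?thesis using m by simp
  qed
  let ?K = "\<integral>x. f x powr (1 + e) \<partial>lborel"
  have K: "0 \<le> ?K" by simp
  have nnK: "(\<integral>\<^sup>+x. ennreal (f x powr (1 + e)) \<partial>lborel) = ennreal ?K"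
    by (rule nn_integral_eq_integral[OF int]) simp
  have pw: "ennreal (f x) * indicator T x \<le>
      ennreal m * indicator T x + ennreal (f x powr (1 + e)) * ennreal (m powr (- e))" for x
  proof -
    have "ennreal (f x) \<le> ennreal m + ennreal (f x powr (1 + e)) * ennreal (m powr (- e))"
      using ennreal_leI[OF split[of x]] m by (simp add: ennreal_mult[symmetric] ennreal_plus[symmetric] del: ennreal_plus)
    then show ?thesis by (cases "x \<in> T") auto
  qed
  have "emeasure (density lborel (\<lambda>x. ennreal (f x))) T = (\<integral>\<^sup>+x. ennreal (f x) * indicator T x \<partial>lborel)"
    using T by (subst emeasure_density) auto
  also have "\<dots> \<le> (\<integral>\<^sup>+x. ennreal m * indicator T x + ennreal (f x powr (1 + e)) * ennreal (m powr (- e)) \<partial>lborel)"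
    by (intro nn_integral_mono pw)
  also have "\<dots> = ennreal m * emeasure lborel T + ennreal ?K * ennreal (m powr (- e))"
    using T by (subst nn_integral_add) (auto simp: nn_integral_multc nn_integral_cmult_indicator nnK)
  also have "\<dots> \<le> ennreal m * ennreal (2 * s) + ennreal ?K * ennreal (m powr (- e))"
    using T by (intro add_mono mult_left_mono) auto
  also have "\<dots> = ennreal (m * (2 * s) + ?K * m powr (- e))"
    using m s K by (simp add: ennreal_mult[symmetric] ennreal_plus[symmetric] del: ennreal_plus)
  also have "m * (2 * s) = 2 * s powr (e / (1 + e))"
  proof -
    have "m * s = s powr (- (1 / (1 + e))) * s powr 1" using s by (simp add: m_def)
    also have "\<dots> = s powr (- (1 / (1 + e)) + 1)" by (rule powr_add[symmetric])
    also have "- (1 / (1 + e)) + 1 = e / (1 + e)" using e by (simp add: field_simps)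
    finally show ?thesis by simp
  qed
  also have "m powr (- e) = s powr (e / (1 + e))" by (simp add: m_def powr_powr)
  finally show ?thesis by (simp add: distrib_right)
qed

text \<open>The change of variables requires an injective quantile function and returns an image
  known only to be Lebesgue measurable. Absence of atoms gives the former, and an open superset
  repairs the latter.\<close>

lemma quantile_derivative_small:
  fixes D :: "real \<Rightarrow> real"
  assumes \<mu>: "real_distribution \<mu>"
    and f: "f \<in> borel_measurable borel" "\<And>x. 0 \<le> f x" "\<mu> = density lborel (\<lambda>x. ennreal (f x))"
    and e: "0 < e" "integrable lborel (\<lambda>x. f x powr (1 + e))"
    and D: "\<And>t. t \<in> {0<..<1} \<Longrightarrow> (quantile \<mu> has_real_derivative D t) (at t)"
    and cD: "continuous_on {0<..<1} D" and s: "0 < s"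
  shows "measure unit_uniform {t \<in> {0<..<1}. D t \<le> s} \<le>
    (2 + (\<integral>x. f x powr (1 + e) \<partial>lborel)) * s powr (e / (1 + e))"
proof -
  let ?q = "quantile \<mu>"
  define A where "A = {t \<in> {0<..<1}. D t \<le> s}"
  have A_sub: "A \<subseteq> {0<..<1}" and A_D: "t \<in> A \<Longrightarrow> D t \<le> s" for t by (auto simp: A_def)
  have qm: "?q \<in> measurable unit_uniform borel"
    using distr_quantile(2)[OF \<mu>] by (simp cong: measurable_cong_sets restrict_space_sets_cong)
  have D0: "0 \<le> D t" if "t \<in> {0<..<1}" for t
    by (rule mono_on_imp_deriv_nonneg[OF quantile_mono_on[OF \<mu>] D[OF that]])
      (use that in \<open>simp add: interior_open\<close>)
  have inj: "inj_on ?q {0<..<1}"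
  proof (rule linorder_inj_onI)
    fix a b :: real assume ab: "a < b" "a \<in> {0<..<1}" "b \<in> {0<..<1}"
    show "?q a \<noteq> ?q b"
    proof
      assume eq: "?q a = ?q b"
      \<comment> \<open>By monotonicity the quantile function would be constant on [a, b], and its
        value there an atom of mass at least b - a, impossible for a law with a density.\<close>
      have const: "?q t = ?q a" if "t \<in> {a..b}" for t
        using mono_onD[OF quantile_mono_on[OF \<mu>], of a t] mono_onD[OF quantile_mono_on[OF \<mu>], of t b]
          that ab eq by force
      have sub: "{a..b} \<subseteq> ?q -` {?q a} \<inter> space unit_uniform"
      proof
        fix t assume t: "t \<in> {a..b}"
        then show "t \<in> ?q -` {?q a} \<inter> space unit_uniform"
          using const[OF t] ab by (simp add: space_restrict_space)
      qed
      have "emeasure unit_uniform {a..b} \<le> emeasure unit_uniform (?q -` {?q a} \<inter> space unit_uniform)"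
        by (rule emeasure_mono[OF sub]) (rule measurable_sets[OF qm], simp)
      also have "\<dots> = emeasure (distr unit_uniform borel ?q) {?q a}"
        by (rule emeasure_distr[symmetric, OF qm]) simp
      also have "\<dots> = emeasure \<mu> {?q a}" by (simp add: distr_quantile(1)[OF \<mu>])
      also have "\<dots> = 0"
        unfolding f(3) using f(1) by (subst emeasure_density) (auto intro!: nn_integral_null_set simp: null_sets_def)
      finally have "emeasure lborel {a..b} \<le> 0"
        using ab by (subst (asm) emeasure_restrict_space) auto
      then show False using ab by simp
    qed
  qed auto
  have "D \<in> borel_measurable (restrict_space borel {0<..<1})"
    by (rule borel_measurable_continuous_on_restrict[OF cD])
  then have "{t \<in> space (restrict_space borel {0<..<1}). D t \<le> s} \<in> sets (restrict_space borel {0<..<1})"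
    by measurable
  then have A_borel: "A \<in> sets borel"
    by (subst (asm) sets_restrict_space_iff) (auto simp: space_restrict_space A_def)
  have AL: "A \<in> lmeasurable"
    by (rule bounded_set_imp_lmeasurable[OF bounded_subset[OF bounded_Ioo A_sub]])
      (use A_borel in simp)
  have "measure lebesgue A \<le> measure lebesgue (cbox 0 (1::real))"
    by (rule measure_mono_fmeasurable[OF _ fmeasurableD[OF AL] lmeasurable_cbox]) (use A_sub in \<open>auto simp: subset_iff less_imp_le\<close>)
  then have mA: "measure lebesgue A \<le> 1" by simp
  have i1: "(\<lambda>x. \<bar>D x\<bar> * 1) absolutely_integrable_on A"
  proof (rule measurable_bounded_by_integrable_imp_absolutely_integrable)
    show "(\<lambda>x. \<bar>D x\<bar> * 1) \<in> borel_measurable (lebesgue_on A)"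
    proof -
      have "continuous_on A (\<lambda>x. \<bar>D x\<bar> * 1)"
        by (intro continuous_intros continuous_on_subset[OF cD A_sub])
      then show ?thesis
        by (rule continuous_imp_measurable_on_sets_lebesgue) (use A_borel in simp)
    qed
    show "(\<lambda>x. s) integrable_on A" using AL by (rule integrable_on_const)
    show "norm (\<bar>D x\<bar> * 1) \<le> s" if "x \<in> A" for x using D0 A_D[OF that] A_sub that by auto
    show "A \<in> sets lebesgue" by (rule fmeasurableD[OF AL])
  qed
  have cv: "(\<lambda>x. \<bar>D x\<bar> * 1) absolutely_integrable_on A \<and> integral A (\<lambda>x. \<bar>D x\<bar> * 1) = integral A (\<lambda>x. \<bar>D x\<bar> * 1)
     \<longleftrightarrow> (\<lambda>_. 1 :: real) absolutely_integrable_on (?q ` A) \<and> integral (?q ` A) (\<lambda>_. 1 :: real) = integral A (\<lambda>x. \<bar>D x\<bar> * 1)"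
  proof (rule has_absolute_integral_change_of_variables_1'[where f="\<lambda>_. 1"])
    show "(?q has_field_derivative D t) (at t within A)" if "t \<in> A" for t
      by (rule has_field_derivative_at_within, rule D) (use that A_sub in blast)
    show "inj_on ?q A" by (rule inj_on_subset[OF inj A_sub])
    show "A \<in> sets lebesgue" by (rule fmeasurableD[OF AL])
  qed
  have imL: "?q ` A \<in> lmeasurable" and imI: "integral (?q ` A) (\<lambda>_. 1 :: real) = integral A (\<lambda>x. \<bar>D x\<bar> * 1)"
    using cv i1 by (auto simp: lmeasurable_iff_integrable_on absolutely_integrable_on_def)
  have "measure lebesgue (?q ` A) = integral (?q ` A) (\<lambda>_. 1)" by (rule lmeasure_integral[OF imL])
  also have "\<dots> \<le> integral A (\<lambda>_. s)"
    unfolding imI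
    by (rule integral_le) (use i1 D0 A_D A_sub in \<open>auto simp: absolutely_integrable_on_def intro!: integrable_on_const AL\<close>)
  also have "\<dots> = s * measure lebesgue A"
    using integral_mult_right[of A s "\<lambda>_. 1"] lmeasure_integral[OF AL] by simp
  also have "\<dots> \<le> s" using mA s by (simp add: mult_left_le)
  finally have im: "measure lebesgue (?q ` A) \<le> s" .
  \<comment> \<open>\<mu> is defined on Borel sets, so the image is replaced by an open superset of
    excess below s. Hence the bound 2 s that is passed on.\<close>
  obtain T where T: "open T" "?q ` A \<subseteq> T" "T - ?q ` A \<in> lmeasurable" "emeasure lebesgue (T - ?q ` A) < ennreal s"
    using sets_lebesgue_outer_open[OF fmeasurableD[OF imL] s] .
  have "emeasure lborel T = emeasure lebesgue (?q ` A \<union> (T - ?q ` A))"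
    using T by (simp add: Un_absorb1)
  also have "\<dots> \<le> emeasure lebesgue (?q ` A) + emeasure lebesgue (T - ?q ` A)"
    using imL T by (intro emeasure_subadditive) auto
  also have "\<dots> \<le> ennreal s + ennreal s"
    using im T(4) imL by (intro add_mono) (auto simp: emeasure_eq_measure2 ennreal_leI)
  finally have eT: "emeasure lborel T \<le> ennreal (2 * s)"
    using s by (simp add: ennreal_plus[symmetric] del: ennreal_plus)
  have sub: "A \<subseteq> ?q -` T \<inter> space unit_uniform" using T(2) A_sub by (auto simp: space_restrict_space)
  have "emeasure unit_uniform A \<le> emeasure unit_uniform (?q -` T \<inter> space unit_uniform)"
    by (rule emeasure_mono[OF sub]) (rule measurable_sets[OF qm], use T in simp)
  also have "\<dots> = emeasure \<mu> T"
    using T(1) by (subst emeasure_distr[symmetric, OF qm]) (simp_all add: distr_quantile(1)[OF \<mu>])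
  also have "\<dots> \<le> ennreal ((2 + (\<integral>x. f x powr (1 + e) \<partial>lborel)) * s powr (e / (1 + e)))"
    unfolding f(3) by (rule density_small_set_bound[OF f(1,2) e _ eT s]) (use T in simp)
  finally show ?thesis
    unfolding A_def[symmetric] measure_def by (intro enn2real_leI) (auto intro!: mult_nonneg_nonneg add_nonneg_nonneg)
qed

text \<open>Up to a constant, the density is the square of the Gaussian density of variance 2. On
  the set in question one factor is at most a multiple of sqrt d, and the other one integrates to
  1.\<close>

lemma gauss_density_small:
  assumes d: "0 < d"
  shows "measure gauss {x. std_normal_density x \<le> d} \<le> sqrt (2 * sqrt (2 * pi) * d)"
proof -
  let ?c = "2 * sqrt (2 * pi)" and ?n = "normal_density 0 (sqrt 2)"
  let ?S = "{x. std_normal_density x \<le> d}"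
  have sq: "std_normal_density x = ?c * (?n x)\<^sup>2" for x
  proof -
    have "(exp (- x\<^sup>2 / 4))\<^sup>2 = exp (- x\<^sup>2 / 2)" by (simp add: power2_eq_square exp_add[symmetric])
    moreover have "?n x = 1 / sqrt (4 * pi) * exp (- x\<^sup>2 / 4)" by (simp add: normal_density_def)
    ultimately have "(?n x)\<^sup>2 = 1 / (4 * pi) * exp (- x\<^sup>2 / 2)"
      by (simp add: power_mult_distrib power_divide)
    moreover have "1 / sqrt (2 * pi) = ?c * (1 / (4 * pi))"
      by (simp add: field_simps)
    ultimately show ?thesis by (simp add: std_normal_density_def)
  qed
  have pw: "std_normal_density x \<le> sqrt (?c * d) * ?n x" if "x \<in> ?S" for x
  proof -
    have "(?c * ?n x)\<^sup>2 \<le> ?c * d"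
      using that sq[of x] by (simp add: power_mult_distrib power2_eq_square mult_left_mono)
    then have "?c * ?n x \<le> sqrt (?c * d)" by (rule real_le_rsqrt)
    then have "?c * ?n x * ?n x \<le> sqrt (?c * d) * ?n x" by (intro mult_right_mono) auto
    then show ?thesis using sq[of x] by (simp add: power2_eq_square mult_ac)
  qed
  have "emeasure gauss ?S = (\<integral>\<^sup>+x. ennreal (std_normal_density x) * indicator ?S x \<partial>lborel)"
    by (rule emeasure_density) auto
  also have "\<dots> \<le> (\<integral>\<^sup>+x. ennreal (sqrt (?c * d) * ?n x) \<partial>lborel)"
    by (intro nn_integral_mono) (auto split: split_indicator intro!: ennreal_leI pw)
  also have "\<dots> = ennreal (\<integral>x. sqrt (?c * d) * ?n x \<partial>lborel)"
    by (rule nn_integral_eq_integral) (use d in auto)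
  also have "\<dots> = ennreal (sqrt (?c * d))" by simp
  finally show ?thesis using d unfolding measure_def by (intro enn2real_leI) auto
qed

text \<open>For \<eta> \<le> 1 the smaller exponent dominates; for larger \<eta> the trivial bound 1
  suffices, which accounts for the added 1 in the constant.\<close>

lemma powr_tail_combine:
  fixes p :: "real \<Rightarrow> real"
  assumes p: "\<And>\<eta>. 0 < \<eta> \<Longrightarrow> p \<eta> \<le> A * \<eta> powr a + B * \<eta> powr b" "\<And>\<eta>. p \<eta> \<le> 1"
    and ab: "0 < a" "0 < b" and AB: "0 \<le> A" "0 \<le> B"
  shows "\<exists>\<theta>>0. \<exists>C>0. \<forall>\<eta>>0. p \<eta> \<le> C * \<eta> powr \<theta>"
proof (intro exI conjI allI impI)
  show "0 < min a b" "0 < A + B + 1" using ab AB by auto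
  fix \<eta> :: real assume \<eta>: "0 < \<eta>"
  show "p \<eta> \<le> (A + B + 1) * \<eta> powr min a b"
  proof (cases "\<eta> \<le> 1")
    case True
    have "A * \<eta> powr a \<le> A * \<eta> powr min a b" "B * \<eta> powr b \<le> B * \<eta> powr min a b"
      using True \<eta> AB by (auto intro!: mult_left_mono powr_mono')
    then have "p \<eta> \<le> A * \<eta> powr min a b + B * \<eta> powr min a b" using p(1)[OF \<eta>] by linarith
    moreover have "0 \<le> \<eta> powr min a b" by simp
    ultimately show ?thesis unfolding distrib_right by linarith
  next
    case False
    then have "1 \<le> \<eta> powr min a b" using ab by (intro ge_one_powr_ge_zero) auto
    then have "1 * 1 \<le> (A + B + 1) * \<eta> powr min a b" using AB by (intro mult_mono) auto
    then show ?thesis using p(2)[of \<eta>] by linarith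
  qed
qed

lemma measure_coordinate:
  assumes "{x. P x} \<in> sets borel"
  shows "measure wiener {\<omega> \<in> space wiener. P (\<omega> j)} = measure gauss {x. P x}"
proof -
  have "measure gauss {x. P x} = measure (distr wiener borel (\<lambda>\<omega>. \<omega> j)) {x. P x}"
    by (simp add: distr_coordinate)
  also have "\<dots> = measure wiener ((\<lambda>\<omega>. \<omega> j) -` {x. P x} \<inter> space wiener)"
    by (rule measure_distr) (use assms in auto)
  also have "(\<lambda>\<omega>. \<omega> j) -` {x. P x} \<inter> space wiener = {\<omega> \<in> space wiener. P (\<omega> j)}" by auto
  finally show ?thesis ..
qed

lemma density_condition_tail:
  assumes \<mu>: "real_distribution \<mu>" and dc: "density_condition \<mu>"
  obtains g \<theta> C where "\<And>x. ((\<lambda>x. quantile \<mu> (Phi x)) has_real_derivative g x) (at x)"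
    "continuous_on UNIV g" "0 < \<theta>" "0 < C"
    "\<And>\<eta>. 0 < \<eta> \<Longrightarrow> measure wiener {\<omega> \<in> space wiener. (g (\<omega> j))\<^sup>2 \<le> \<eta>} \<le> C * \<eta> powr \<theta>"
proof -
  obtain D where D: "\<And>t. t \<in> {0<..<1} \<Longrightarrow> (quantile \<mu> has_real_derivative D t) (at t)"
    and cD: "continuous_on {0<..<1} D"
    using dc unfolding density_condition_def C1_differentiable_on_def
      has_real_derivative_iff_has_vector_derivative by blast
  obtain e f where e: "0 < e" "integrable lborel (\<lambda>x. f x powr (1 + e))"
    and f: "f \<in> borel_measurable borel" "\<And>x. 0 \<le> f x" "\<mu> = density lborel (\<lambda>x. ennreal (f x))"
    using dc unfolding density_condition_def by blast
  define g where "g x = D (Phi x) * std_normal_density x" for x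
  have P: "Phi x \<in> {0<..<1}" for x by (simp add: Phi_bounds)
  have dg: "((\<lambda>x. quantile \<mu> (Phi x)) has_real_derivative g x) (at x)" for x
    unfolding g_def by (rule DERIV_chain2[OF D[OF P] DERIV_Phi])
  have cphi: "continuous_on UNIV std_normal_density"
    by (intro continuous_at_imp_continuous_on) (blast intro: DERIV_isCont DERIV_std_normal_density)
  have cDP: "continuous_on UNIV (\<lambda>x. D (Phi x))"
    by (rule continuous_on_compose2[OF cD Phi_continuous]) (use P in blast)
  have cg: "continuous_on UNIV g"
    unfolding g_def[abs_def] by (intro continuous_on_mult cDP cphi)
  have [measurable]: "(\<lambda>x. D (Phi x)) \<in> borel_measurable borel" "g \<in> borel_measurable borel"
    by (intro borel_measurable_continuous_onI cDP cg)+
  define K where "K = 2 + (\<integral>x. f x powr (1 + e) \<partial>lborel)"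
  have K: "0 \<le> K" unfolding K_def by (intro add_nonneg_nonneg) auto
  have small_D: "measure gauss {x. D (Phi x) \<le> s} \<le> K * s powr (e / (1 + e))" if s: "0 < s" for s
  proof -
    have "D \<in> borel_measurable (restrict_space borel {0<..<1})"
      by (rule borel_measurable_continuous_on_restrict[OF cD])
    then have "D \<in> borel_measurable unit_uniform"
      by (simp cong: measurable_cong_sets restrict_space_sets_cong)
    then have "{t \<in> space unit_uniform. D t \<le> s} \<in> sets unit_uniform" by measurable
    then have m: "{t \<in> {0<..<1}. D t \<le> s} \<in> sets unit_uniform" by (simp add: space_restrict_space)
    have "Phi -` {t \<in> {0<..<1}. D t \<le> s} \<inter> space gauss = {x. D (Phi x) \<le> s}" using Phi_bounds by auto
    then have "measure gauss {x. D (Phi x) \<le> s} = measure (distr gauss unit_uniform Phi) {t \<in> {0<..<1}. D t \<le> s}"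
      using measure_distr[OF measurable_Phi m] by simp
    also have "\<dots> \<le> K * s powr (e / (1 + e))"
      unfolding distr_Phi K_def by (rule quantile_derivative_small[OF \<mu> f e D cD s])
    finally show ?thesis .
  qed
  let ?p = "\<lambda>\<eta>. measure wiener {\<omega> \<in> space wiener. (g (\<omega> j))\<^sup>2 \<le> \<eta>}"
  have bound: "?p \<eta> \<le> K * \<eta> powr (e / (1 + e) / 4) + sqrt (2 * sqrt (2 * pi)) * \<eta> powr (1 / 8)"
    if \<eta>: "0 < \<eta>" for \<eta>
  proof -
    \<comment> \<open>If both factors of g exceed s, then g^2 > s^4 = \<eta>. The common threshold
      yields the exponents e / (4 (1 + e)) and 1 / 8.\<close>
    define s where "s = \<eta> powr (1 / 4)"
    have s: "0 < s" using \<eta> by (simp add: s_def)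
    have s4: "(s * s)\<^sup>2 = \<eta>"
      using \<eta> by (simp add: s_def powr_add[symmetric] power2_eq_square)
    have sub: "{x. (g x)\<^sup>2 \<le> \<eta>} \<subseteq> {x. D (Phi x) \<le> s} \<union> {x. std_normal_density x \<le> s}"
    proof
      fix x assume x: "x \<in> {x. (g x)\<^sup>2 \<le> \<eta>}"
      show "x \<in> {x. D (Phi x) \<le> s} \<union> {x. std_normal_density x \<le> s}"
      proof (rule ccontr)
        assume "x \<notin> {x. D (Phi x) \<le> s} \<union> {x. std_normal_density x \<le> s}"
        then have "s * s < g x" unfolding g_def using s by (intro mult_strict_mono) auto
        then have "(s * s)\<^sup>2 < (g x)\<^sup>2" using s by (intro power_strict_mono) auto
        then show False using x s4 by simp
      qed
    qed
    have "?p \<eta> = measure gauss {x. (g x)\<^sup>2 \<le> \<eta>}"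
      by (rule measure_coordinate) measurable
    also have "\<dots> \<le> measure gauss ({x. D (Phi x) \<le> s} \<union> {x. std_normal_density x \<le> s})"
    proof (rule gauss.finite_measure_mono[OF sub])
      have "{x \<in> space borel. D (Phi x) \<le> s} \<union> {x \<in> space borel. std_normal_density x \<le> s} \<in> sets borel"
        by measurable
      then show "{x. D (Phi x) \<le> s} \<union> {x. std_normal_density x \<le> s} \<in> sets gauss" by simp
    qed
    also have "\<dots> \<le> measure gauss {x. D (Phi x) \<le> s} + measure gauss {x. std_normal_density x \<le> s}"
    proof (rule measure_Un_le)
      have "{x \<in> space borel. D (Phi x) \<le> s} \<in> sets borel" by measurable
      then show "{x. D (Phi x) \<le> s} \<in> sets gauss" by simp
      have "{x \<in> space borel. std_normal_density x \<le> s} \<in> sets borel" by measurable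
      then show "{x. std_normal_density x \<le> s} \<in> sets gauss" by simp
    qed
    also have "\<dots> \<le> K * s powr (e / (1 + e)) + sqrt (2 * sqrt (2 * pi) * s)"
      by (intro add_mono small_D gauss_density_small s)
    also have "s powr (e / (1 + e)) = \<eta> powr (e / (1 + e) / 4)" by (simp add: s_def powr_powr mult.commute)
    also have "sqrt (2 * sqrt (2 * pi) * s) = sqrt (2 * sqrt (2 * pi)) * sqrt s" by (rule real_sqrt_mult)
    also have "sqrt s = \<eta> powr (1 / 8)"
      using s by (simp add: powr_half_sqrt[symmetric] s_def powr_powr)
    finally show ?thesis .
  qed
  have "\<exists>\<theta>>0. \<exists>C>0. \<forall>\<eta>>0. ?p \<eta> \<le> C * \<eta> powr \<theta>"
    by (rule powr_tail_combine[OF bound]) (use e K in \<open>auto intro: wiener.prob_le_1\<close>)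
  then show ?thesis using that[OF dg cg] by blast
qed

text \<open>Dyadic decomposition of the values of Z. With the exponent halved, the n-th term has
  size d_n^(-\<theta>/2) and probability of order d_n^\<theta>, where d_n = 2^(-n), so the sum is
  geometric.\<close>

lemma (in prob_space) nn_integral_neg_power_finite:
  assumes [measurable]: "Z \<in> borel_measurable M" and \<theta>: "0 < \<theta>" and C: "0 < C"
    and tail: "\<And>\<eta>. 0 < \<eta> \<Longrightarrow> prob {\<omega> \<in> space M. Z \<omega> \<le> \<eta>} \<le> C * \<eta> powr \<theta>"
  shows "(\<integral>\<^sup>+\<omega>. neg_power (\<theta> / 2) (Z \<omega>) \<partial>M) < \<infinity>"
proof -
  define d where "d n = (1 / 2 :: real) ^ n" for n :: nat
  have d: "0 < d n" for n by (simp add: d_def)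
  have d_powr: "d n powr a = (2 powr (- a)) ^ n" for n a
    by (simp add: d_def powr_realpow[symmetric] powr_powr powr_minus inverse_eq_divide powr_divide mult.commute)
  let ?E = "\<lambda>n. {\<omega> \<in> space M. Z \<omega> \<le> d n}"
  \<comment> \<open>\<open>neg_power\<close> is infinite at nonpositive values, so these have to be
    null; the tail bound along \<open>d n\<close> shows it.\<close>
  have pos: "AE \<omega> in M. 0 < Z \<omega>"
  proof -
    have "prob {\<omega> \<in> space M. Z \<omega> \<le> 0} \<le> C * d n powr \<theta>" for n
    proof -
      have "prob {\<omega> \<in> space M. Z \<omega> \<le> 0} \<le> prob (?E n)"
        using d[of n] by (intro finite_measure_mono) auto
      then show ?thesis using tail[OF d[of n]] by linarith
    qed
    moreover have "(\<lambda>n. C * d n powr \<theta>) \<longlonglongrightarrow> C * 0"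
      unfolding d_powr using \<theta> by (intro tendsto_intros LIMSEQ_power_zero) (simp add: powr_less_one)
    ultimately have "prob {\<omega> \<in> space M. Z \<omega> \<le> 0} \<le> C * 0"
      by (intro tendsto_lowerbound[OF _ always_eventually]) auto
    then have "prob {\<omega> \<in> space M. Z \<omega> \<le> 0} = 0" using measure_nonneg[of M] by (simp add: order_antisym)
    then show ?thesis
      by (subst (asm) prob_eq_0) (auto simp: not_le)
  qed
  \<comment> \<open>Only the term with d (Suc n) < z \<le> d n is used; summing over all n with z
    \<le> d n overcounts but matches the form of the tail bound.\<close>
  have pw: "neg_power (\<theta> / 2) z \<le> 1 + (\<Sum>n. ennreal (d (Suc n) powr (- (\<theta> / 2))) * indicator {..d n} z)"
    (is "_ \<le> 1 + ?S") if z: "0 < z" for z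
  proof (cases "z \<le> 1")
    case False
    then have "z powr (- (\<theta> / 2)) \<le> 1" using \<theta> powr_mono[of "- (\<theta> / 2)" 0 z] by simp
    then have "neg_power (\<theta> / 2) z \<le> 1" using z by (simp add: neg_power_def)
    then show ?thesis by (rule order_trans) simp
  next
    case True
    have ex: "\<exists>n. d (Suc n) < z"
    proof -
      obtain n where "(1 / 2 :: real) ^ n < z" using real_arch_pow_inv[OF z, of "1 / 2"] by auto
      then have "d (Suc n) < z" using z by (simp add: d_def)
      then show ?thesis ..
    qed
    \<comment> \<open>Minimality gives z \<le> d n, except for n = 0, where the case assumption z
      \<le> 1 = d 0 takes over.\<close>
    define n where "n = (LEAST n. d (Suc n) < z)"
    have n: "d (Suc n) < z" unfolding n_def by (rule LeastI_ex[OF ex])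
    have zn: "z \<le> d n"
    proof (cases n)
      case 0
      then show ?thesis using True by (simp add: d_def)
    next
      case (Suc k)
      then have "\<not> d (Suc k) < z" using not_less_Least[of k "\<lambda>n. d (Suc n) < z"] n_def by simp
      then show ?thesis using Suc by simp
    qed
    have "z powr (- (\<theta> / 2)) \<le> d (Suc n) powr (- (\<theta> / 2))"
      using n \<theta> d by (intro powr_mono2') auto
    then have "neg_power (\<theta> / 2) z \<le> ennreal (d (Suc n) powr (- (\<theta> / 2))) * indicator {..d n} z"
      using z zn by (simp add: neg_power_def ennreal_leI)
    also have "\<dots> = (\<Sum>n\<in>{n}. ennreal (d (Suc n) powr (- (\<theta> / 2))) * indicator {..d n} z)"
      by (simp only: sum.insert finite.emptyI empty_iff not_False_eq_True sum.empty add_0_right)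
    also have "\<dots> \<le> ?S" by (rule sum_le_suminf) auto
    finally show ?thesis by (rule order_trans) simp
  qed
  let ?r = "2 powr (- (\<theta> / 2))"
  have r: "0 < ?r" "?r < 1" using \<theta> by (simp_all add: powr_less_one)
  have "(\<integral>\<^sup>+\<omega>. neg_power (\<theta> / 2) (Z \<omega>) \<partial>M) \<le>
      (\<integral>\<^sup>+\<omega>. 1 + (\<Sum>n. ennreal (d (Suc n) powr (- (\<theta> / 2))) * indicator {..d n} (Z \<omega>)) \<partial>M)"
    by (rule nn_integral_mono_AE) (use pos pw in \<open>auto elim: eventually_mono\<close>)
  also have "\<dots> = 1 + (\<Sum>n. \<integral>\<^sup>+\<omega>. ennreal (d (Suc n) powr (- (\<theta> / 2))) * indicator {..d n} (Z \<omega>) \<partial>M)"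
    by (subst nn_integral_add) (auto simp: nn_integral_suminf emeasure_space_1)
  also have "\<dots> \<le> 1 + (\<Sum>n. ennreal (C / ?r * ?r ^ n))"
  proof (intro add_mono order_refl suminf_le)
    fix n
    have "(\<integral>\<^sup>+\<omega>. ennreal (d (Suc n) powr (- (\<theta> / 2))) * indicator {..d n} (Z \<omega>) \<partial>M)
        = (\<integral>\<^sup>+\<omega>. ennreal (d (Suc n) powr (- (\<theta> / 2))) * indicator (?E n) \<omega> \<partial>M)"
      by (rule nn_integral_cong) (auto split: split_indicator)
    also have "\<dots> = ennreal (d (Suc n) powr (- (\<theta> / 2))) * emeasure M (?E n)"
      by (rule nn_integral_cmult_indicator) measurable
    also have "\<dots> = ennreal (d (Suc n) powr (- (\<theta> / 2)) * prob (?E n))"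
      by (simp add: emeasure_eq_measure ennreal_mult)
    also have "\<dots> \<le> ennreal (C / ?r * ?r ^ n)"
    proof (rule ennreal_leI)
      have 1: "d (Suc n) powr (- (\<theta> / 2)) = 1 / ?r * (1 / ?r) ^ n"
        by (simp add: d_powr powr_minus inverse_eq_divide power_divide)
      have 2: "d n powr \<theta> = ?r ^ n * ?r ^ n"
        unfolding d_powr power_mult_distrib[symmetric] powr_add[symmetric] by simp
      \<comment> \<open>The power contributes r^(-(n+1)) and the tail C r^(2 n), which leaves C r^n
        / r.\<close>
      have "d (Suc n) powr (- (\<theta> / 2)) * prob (?E n) \<le> d (Suc n) powr (- (\<theta> / 2)) * (C * d n powr \<theta>)"
        by (intro mult_left_mono tail d) simp
      also have "\<dots> = C / ?r * ?r ^ n"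
        unfolding 1 2 using r by (simp add: power_divide field_simps)
      finally show "d (Suc n) powr (- (\<theta> / 2)) * prob (?E n) \<le> C / ?r * ?r ^ n" .
    qed
    finally show "(\<integral>\<^sup>+\<omega>. ennreal (d (Suc n) powr (- (\<theta> / 2))) * indicator {..d n} (Z \<omega>) \<partial>M)
        \<le> ennreal (C / ?r * ?r ^ n)" .
  qed auto
  also have "\<dots> < \<infinity>"
  proof -
    have "summable (\<lambda>n. C / ?r * ?r ^ n)" using r by (intro summable_mult summable_geometric) auto
    then have "(\<Sum>n. ennreal (C / ?r * ?r ^ n)) = ennreal (\<Sum>n. C / ?r * ?r ^ n)"
      using C r by (intro suminf_ennreal2) auto
    then show ?thesis by simp
  qed
  finally show ?thesis .
qed

theorem theorem3p1:
  fixes \<mu> :: "real measure" and I :: "real set" and j :: nat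
    and N X :: "(nat \<Rightarrow> real) \<Rightarrow> real"
  assumes "real_distribution \<mu>"
    and "is_interval I" and "AE x in \<mu>. x \<in> I"
    and N: "N = (\<lambda>\<omega>. \<omega> j)"
    and X: "X = (\<lambda>\<omega>. quantile \<mu> (Phi (N \<omega>)))"
  shows "(smooth_quantile_condition \<mu> I \<longrightarrow> X \<in> D_infty) \<and>
    (density_condition \<mu> \<longrightarrow>
      (\<exists>G. is_gamma_loc X G \<and>
        (\<exists>\<theta>>0. \<exists>C>0. \<forall>\<eta>>0.
          measure wiener {\<omega> \<in> space wiener. G \<omega> \<le> \<eta>} \<le> C * \<eta> powr \<theta>))) \<and>
    (smooth_quantile_condition \<mu> I \<and> density_condition \<mu> \<longrightarrow> \<mu> \<in> law_class)"
proof -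
  let ?T = "\<lambda>x. quantile \<mu> (Phi x)"
  have X_eq: "X = (\<lambda>\<omega>. ?T (\<omega> j))" using N X by simp
  have tame: "tame ?T" if "smooth_quantile_condition \<mu> I"
    using that unfolding smooth_quantile_condition_def smooth_diffeo_def
    by (intro tame_comp_Phi) auto
  have smooth: "X \<in> D_infty" if "smooth_quantile_condition \<mu> I"
    unfolding X_eq by (rule tame_coordinate_function_D_infty[OF tame[OF that]])
  have density: "\<exists>G. is_gamma_loc X G \<and> (\<exists>\<theta>>0. \<exists>C>0. \<forall>\<eta>>0.
      measure wiener {\<omega> \<in> space wiener. G \<omega> \<le> \<eta>} \<le> C * \<eta> powr \<theta>)" if dc: "density_condition \<mu>"
  proof -
    obtain g \<theta> C where g: "\<And>x. (?T has_real_derivative g x) (at x)" "continuous_on UNIV g"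
      and "0 < \<theta>" "0 < C"
      "\<And>\<eta>. 0 < \<eta> \<Longrightarrow> measure wiener {\<omega> \<in> space wiener. (g (\<omega> j))\<^sup>2 \<le> \<eta>} \<le> C * \<eta> powr \<theta>"
      using density_condition_tail[OF assms(1) dc, of j] by blast
    then show ?thesis unfolding X_eq using is_gamma_loc_C1[OF g, of j] by blast
  qed
  have law: "\<mu> \<in> law_class" if sq: "smooth_quantile_condition \<mu> I" and dc: "density_condition \<mu>"
  proof -
    obtain g \<theta> C where g: "\<And>x. (?T has_real_derivative g x) (at x)" "continuous_on UNIV g"
      and \<theta>: "0 < \<theta>" "0 < C"
      "\<And>\<eta>. 0 < \<eta> \<Longrightarrow> measure wiener {\<omega> \<in> space wiener. (g (\<omega> j))\<^sup>2 \<le> \<eta>} \<le> C * \<eta> powr \<theta>"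
      using density_condition_tail[OF assms(1) dc, of j] by blast
    \<comment> \<open>\<open>law_class\<close> asks for the global carre du champ, which tameness of
      T gives in terms of \<open>deriv\<close>; uniqueness of derivatives identifies it with the g
      of the tail bound.\<close>
    have "deriv ?T = g" using g(1) by (intro ext DERIV_imp_deriv)
    then have G: "is_gamma X X (\<lambda>\<omega>. (g (\<omega> j))\<^sup>2)"
      unfolding X_eq using is_gamma_tame[OF tame[OF sq], of j] by simp
    then have "(\<lambda>\<omega>. (g (\<omega> j))\<^sup>2) \<in> borel_measurable wiener" by (simp add: is_gamma_def)
    from wiener.nn_integral_neg_power_finite[OF this \<theta>]
    have "(\<integral>\<^sup>+\<omega>. neg_power (\<theta> / 2) ((g (\<omega> j))\<^sup>2) \<partial>wiener) < \<infinity>" .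
    moreover have "distr wiener borel X = \<mu>"
      unfolding X_eq by (rule distr_quantile_Phi_coordinate[OF assms(1)])
    moreover have "0 < \<theta> / 2" using \<theta> by simp
    ultimately show ?thesis unfolding law_class_def using smooth[OF sq] G by blast
  qed
  show ?thesis using smooth density law by blast
qed

end
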